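(* Let $R$ be an integral domain of characteristic $0$, and let $L$ be a non-commutative free Lie algebra over $R$. Identify $\mathbb N$ with the subset $\{0,1,1+1,\dots\}$ of $R$. For $u,b\in L$ and $k\in R$, write $u(b+k):=ub+ku$. For $b\in L$ and $x\in R$, let $\phi(x,b)$ be the condition: there exist $v\in L$ with $v\neq0$ and $u\in L$ such that, for all $k\in R$ and all $u_1\in L$, there exists $u_2\in L$ with $$v=ub\ \wedge\ \big(v=u_1(b+k)\ \Rightarrow\ (v=u_2(b+k+1)\ \vee\ k=x)\big).$$ (1) For every $b\in L$ with $b\neq0$, the set $\{x\in R\mid \phi(x,b)\text{ holds in }L\}$ equals $\mathbb N$. (2) The set $\{x\in R\mid \exists b\in L\,(b\neq0\wedge\phi(x,b))\}$ equals $\mathbb N$. Consequently, $\mathbb N\subseteq R$ is 0-interpretable in $L$, viewed as a ring in the language $\{+,\cdot,0\}$.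
   Context: A free Lie algebra is non-commutative when its rank is at least 2. In the paper the quantifiers over $R$ and the scalar action of $R$ on $L$ in $\phi$ are expressed through a parameter-free interpretation of the ring $R$ and its action on $L$ inside $L$. Therefore $\phi(x,b)$ is a first-order formula of the ring language of $L$. 0-interpretable means interpretable by first-order formulas of the ring language without parameters. Such an interpretation consists of a definable subset of some power $L^n$, a definable equivalence relation on it, and definable relations on the quotient giving a structure isomorphic to the target. *)

theory Defs
  imports Complex_Main
begin

locale lie_algebra = module scale
  for scale :: "'r::comm_ring_1 \<Rightarrow> 'l::ab_group_add \<Rightarrow> 'l" +
  fixes brk :: "'l \<Rightarrow> 'l \<Rightarrow> 'l"
  assumes brk_add_left: "brk (x + y) z = brk x z + brk y z"
    and brk_add_right: "brk x (y + z) = brk x y + brk x z"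
    and brk_scale_left: "brk (scale r x) y = scale r (brk x y)"
    and brk_scale_right: "brk x (scale r y) = scale r (brk x y)"
    and brk_alternating: "brk x x = 0"
    and jacobi: "brk x (brk y z) + brk y (brk z x) + brk z (brk x y) = 0"

text \<open>
  The free Lie algebra on a set \<open>X\<close> is presented as formal Lie expressions in \<open>X\<close> modulo
  the congruence generated by the module and Lie algebra identities; \<open>-t\<close> is
  \<open>LScale (-1) t\<close>.
\<close>

datatype (lgens: 'x, 'r) lie_term =
    LGen 'x
  | LZero
  | LAdd "('x, 'r) lie_term" "('x, 'r) lie_term"
  | LScale 'r "('x, 'r) lie_term"
  | LBrk "('x, 'r) lie_term" "('x, 'r) lie_term"

inductive lie_cong :: "('x, 'r::comm_ring_1) lie_term \<Rightarrow> ('x, 'r) lie_term \<Rightarrow> bool" where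
  lc_refl: "lie_cong s s"
| lc_sym: "lie_cong s t \<Longrightarrow> lie_cong t s"
| lc_trans: "lie_cong s t \<Longrightarrow> lie_cong t u \<Longrightarrow> lie_cong s u"
| lc_cong_add: "lie_cong s s' \<Longrightarrow> lie_cong t t' \<Longrightarrow> lie_cong (LAdd s t) (LAdd s' t')"
| lc_cong_scale: "lie_cong s s' \<Longrightarrow> lie_cong (LScale r s) (LScale r s')"
| lc_cong_brk: "lie_cong s s' \<Longrightarrow> lie_cong t t' \<Longrightarrow> lie_cong (LBrk s t) (LBrk s' t')"
| lc_add_assoc: "lie_cong (LAdd (LAdd s t) u) (LAdd s (LAdd t u))"
| lc_add_comm: "lie_cong (LAdd s t) (LAdd t s)"
| lc_add_zero: "lie_cong (LAdd LZero s) s"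
| lc_add_inverse: "lie_cong (LAdd s (LScale (-1) s)) LZero"
| lc_scale_add_right: "lie_cong (LScale r (LAdd s t)) (LAdd (LScale r s) (LScale r t))"
| lc_scale_add_left: "lie_cong (LScale (r + q) s) (LAdd (LScale r s) (LScale q s))"
| lc_scale_scale: "lie_cong (LScale r (LScale q s)) (LScale (r * q) s)"
| lc_scale_one: "lie_cong (LScale 1 s) s"
| lc_brk_add_left: "lie_cong (LBrk (LAdd s t) u) (LAdd (LBrk s u) (LBrk t u))"
| lc_brk_add_right: "lie_cong (LBrk s (LAdd t u)) (LAdd (LBrk s t) (LBrk s u))"
| lc_brk_scale_left: "lie_cong (LBrk (LScale r s) t) (LScale r (LBrk s t))"
| lc_brk_scale_right: "lie_cong (LBrk s (LScale r t)) (LScale r (LBrk s t))"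
| lc_brk_alternating: "lie_cong (LBrk s s) LZero"
| lc_jacobi:
    "lie_cong (LAdd (LAdd (LBrk s (LBrk t u)) (LBrk t (LBrk u s))) (LBrk u (LBrk s t))) LZero"

primrec lie_eval ::
  "('r \<Rightarrow> 'l::ab_group_add \<Rightarrow> 'l) \<Rightarrow> ('l \<Rightarrow> 'l \<Rightarrow> 'l) \<Rightarrow> ('x \<Rightarrow> 'l) \<Rightarrow> ('x, 'r) lie_term \<Rightarrow> 'l"
where
  "lie_eval scale brk f (LGen x) = f x"
| "lie_eval scale brk f LZero = 0"
| "lie_eval scale brk f (LAdd s t) = lie_eval scale brk f s + lie_eval scale brk f t"
| "lie_eval scale brk f (LScale r t) = scale r (lie_eval scale brk f t)"
| "lie_eval scale brk f (LBrk s t) = brk (lie_eval scale brk f s) (lie_eval scale brk f t)"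

text \<open>
  \<open>X\<close> is a free basis of \<open>L\<close> iff evaluation induces an isomorphism from the free Lie algebra
  on \<open>X\<close> onto \<open>L\<close>. The universal property quantifies over Lie algebras of every type,
  so it cannot be the defining formula; it is the theorem \<open>free_lie_basis_universal\<close>.
\<close>

definition free_lie_basis ::
  "('r::comm_ring_1 \<Rightarrow> 'l::ab_group_add \<Rightarrow> 'l) \<Rightarrow> ('l \<Rightarrow> 'l \<Rightarrow> 'l) \<Rightarrow> 'l set \<Rightarrow> bool"
where
  "free_lie_basis scale brk X \<longleftrightarrow>
     (\<forall>y. \<exists>t. lgens t \<subseteq> X \<and> lie_eval scale brk id t = y) \<and>
     (\<forall>s t. lgens s \<subseteq> X \<longrightarrow> lgens t \<subseteq> X \<longrightarrow>
        lie_eval scale brk id s = lie_eval scale brk id t \<longrightarrow> lie_cong s t)"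

locale free_lie_algebra = lie_algebra +
  assumes ex_free_basis: "\<exists>X. free_lie_basis scale brk X"

definition lie_hom ::
  "('r \<Rightarrow> 'l::ab_group_add \<Rightarrow> 'l) \<Rightarrow> ('l \<Rightarrow> 'l \<Rightarrow> 'l) \<Rightarrow>
   ('r \<Rightarrow> 'm::ab_group_add \<Rightarrow> 'm) \<Rightarrow> ('m \<Rightarrow> 'm \<Rightarrow> 'm) \<Rightarrow> ('l \<Rightarrow> 'm) \<Rightarrow> bool"
where
  "lie_hom scale brk scale' brk' h \<longleftrightarrow>
     (\<forall>x y. h (x + y) = h x + h y) \<and> (\<forall>r x. h (scale r x) = scale' r (h x)) \<and>
     (\<forall>x y. h (brk x y) = brk' (h x) (h y))"

lemma (in lie_algebra) lie_eval_cong: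
  assumes "lie_cong s t"
  shows "lie_eval scale brk f s = lie_eval scale brk f t"
  using assms
  by induction (auto simp: algebra_simps brk_add_left brk_add_right brk_scale_left
      brk_scale_right brk_alternating jacobi[unfolded add.assoc])

lemma lie_hom_eval:
  assumes "lie_hom scale brk scale' brk' h"
  shows "h (lie_eval scale brk f t) = lie_eval scale' brk' (h \<circ> f) t"
proof -
  have "h 0 + h 0 = h 0 + 0"
    using assms unfolding lie_hom_def by (metis add.right_neutral)
  then have "h 0 = 0" by (rule add_left_imp_eq)
  with assms show ?thesis by (induction t) (auto simp: lie_hom_def)
qed

lemma lie_eval_gens_cong:
  assumes "\<And>x. x \<in> lgens t \<Longrightarrow> f x = g x"
  shows "lie_eval scale brk f t = lie_eval scale brk g t"
  using assms by (induction t) auto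

theorem free_lie_basis_universal:
  fixes scale :: "'r::comm_ring_1 \<Rightarrow> 'l::ab_group_add \<Rightarrow> 'l"
    and scale' :: "'r \<Rightarrow> 'm::ab_group_add \<Rightarrow> 'm"
  assumes L: "lie_algebra scale brk" and M: "lie_algebra scale' brk'"
    and X: "free_lie_basis scale brk X"
  shows "\<exists>!h. lie_hom scale brk scale' brk' h \<and> (\<forall>x\<in>X. h x = f x)"
proof -
  let ?ev = "lie_eval scale brk id" and ?ev' = "lie_eval scale' brk' f"
  from X obtain T where T: "\<And>y. lgens (T y) \<subseteq> X" "\<And>y. ?ev (T y) = y"
    unfolding free_lie_basis_def by metis
  define h where "h y = ?ev' (T y)" for y
  have h: "h (?ev t) = ?ev' t" if "lgens t \<subseteq> X" for t
    unfolding h_def using X T that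
    by (intro lie_algebra.lie_eval_cong[OF M]) (auto simp: free_lie_basis_def)
  have hom: "lie_hom scale brk scale' brk' h"
    unfolding lie_hom_def
  proof (intro conjI allI)
    fix x y r
    show "h (x + y) = h x + h y"
      using h[of "LAdd (T x) (T y)"] T by (simp add: h_def)
    show "h (scale r x) = scale' r (h x)"
      using h[of "LScale r (T x)"] T by (simp add: h_def)
    show "h (brk x y) = brk' (h x) (h y)"
      using h[of "LBrk (T x) (T y)"] T by (simp add: h_def)
  qed
  have gen: "\<forall>x\<in>X. h x = f x"
    using h[of "LGen x" for x] by auto
  show ?thesis
  proof (intro ex1I[of _ h] conjI hom gen ext)
    fix h' y assume h': "lie_hom scale brk scale' brk' h' \<and> (\<forall>x\<in>X. h' x = f x)"
    have "h' (?ev (T y)) = lie_eval scale' brk' (h' \<circ> id) (T y)"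
      using h' lie_hom_eval by blast
    also have "\<dots> = ?ev' (T y)"
      using h' T(1)[of y] by (intro lie_eval_gens_cong) auto
    finally show "h' y = h y" using T by (simp add: h_def)
  qed
qed

text \<open>\<open>brk_shift scale brk u b k\<close> is \<open>u(b + k) = ub + ku\<close>; the sum \<open>b + k\<close> is not an element of \<open>L\<close>.\<close>

definition brk_shift ::
  "('r \<Rightarrow> 'l::ab_group_add \<Rightarrow> 'l) \<Rightarrow> ('l \<Rightarrow> 'l \<Rightarrow> 'l) \<Rightarrow> 'l \<Rightarrow> 'l \<Rightarrow> 'r \<Rightarrow> 'l"
where
  "brk_shift scale brk u b k = brk u b + scale k u"

definition phi ::
  "('r::comm_ring_1 \<Rightarrow> 'l::ab_group_add \<Rightarrow> 'l) \<Rightarrow> ('l \<Rightarrow> 'l \<Rightarrow> 'l) \<Rightarrow> 'r \<Rightarrow> 'l \<Rightarrow> bool"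
where
  "phi scale brk x b \<longleftrightarrow>
     (\<exists>v. v \<noteq> 0 \<and> (\<exists>u. \<forall>k u1. \<exists>u2.
        v = brk u b \<and>
        (v = brk_shift scale brk u1 b k \<longrightarrow>
           v = brk_shift scale brk u2 b (k + 1) \<or> k = x)))"

datatype ring_term =
    RVar nat
  | RZero
  | RPlus ring_term ring_term
  | RTimes ring_term ring_term

datatype ring_fm =
    FEq ring_term ring_term
  | FNot ring_fm
  | FAnd ring_fm ring_fm
  | FEx nat ring_fm

primrec rt_vars :: "ring_term \<Rightarrow> nat set" where
  "rt_vars (RVar i) = {i}"
| "rt_vars RZero = {}"
| "rt_vars (RPlus s t) = rt_vars s \<union> rt_vars t"
| "rt_vars (RTimes s t) = rt_vars s \<union> rt_vars t"

primrec free_vars :: "ring_fm \<Rightarrow> nat set" where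
  "free_vars (FEq s t) = rt_vars s \<union> rt_vars t"
| "free_vars (FNot p) = free_vars p"
| "free_vars (FAnd p q) = free_vars p \<union> free_vars q"
| "free_vars (FEx i p) = free_vars p - {i}"

primrec rt_val :: "('l::ab_group_add \<Rightarrow> 'l \<Rightarrow> 'l) \<Rightarrow> (nat \<Rightarrow> 'l) \<Rightarrow> ring_term \<Rightarrow> 'l" where
  "rt_val mul e (RVar i) = e i"
| "rt_val mul e RZero = 0"
| "rt_val mul e (RPlus s t) = rt_val mul e s + rt_val mul e t"
| "rt_val mul e (RTimes s t) = mul (rt_val mul e s) (rt_val mul e t)"

primrec ring_sat :: "('l::ab_group_add \<Rightarrow> 'l \<Rightarrow> 'l) \<Rightarrow> (nat \<Rightarrow> 'l) \<Rightarrow> ring_fm \<Rightarrow> bool" where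
  "ring_sat mul e (FEq s t) \<longleftrightarrow> rt_val mul e s = rt_val mul e t"
| "ring_sat mul e (FNot p) \<longleftrightarrow> \<not> ring_sat mul e p"
| "ring_sat mul e (FAnd p q) \<longleftrightarrow> ring_sat mul e p \<and> ring_sat mul e q"
| "ring_sat mul e (FEx i p) \<longleftrightarrow> (\<exists>a. ring_sat mul (e(i := a)) p)"

text \<open>
  The target is a relational structure with universe \<open>A\<close> in which the symbol \<open>s\<close> denotes the
  relation \<open>rel s\<close> of arity \<open>ar s\<close>. Tuples are lists, and a tuple \<open>xs\<close> assigns \<open>xs ! i\<close>
  to variable \<open>i\<close>. The bounds on the free variables rule out parameters, and make the values
  of \<open>xs ! i\<close> beyond the length of \<open>xs\<close> irrelevant.
\<close>

definition zero_interpretable ::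
  "'a set \<Rightarrow> ('s \<Rightarrow> nat) \<Rightarrow> ('s \<Rightarrow> 'a list \<Rightarrow> bool) \<Rightarrow> ('l::ab_group_add \<Rightarrow> 'l \<Rightarrow> 'l) \<Rightarrow> bool"
where
  "zero_interpretable A ar rel mul \<longleftrightarrow>
     (\<exists>n dom_fm eq_fm rel_fm D E g.
        free_vars dom_fm \<subseteq> {..<n} \<and>
        free_vars eq_fm \<subseteq> {..<2 * n} \<and>
        (\<forall>s. free_vars (rel_fm s) \<subseteq> {..<ar s * n}) \<and>
        D = {xs. length xs = n \<and> ring_sat mul ((!) xs) dom_fm} \<and>
        E = {(xs, ys). xs \<in> D \<and> ys \<in> D \<and> ring_sat mul ((!) (xs @ ys)) eq_fm} \<and>
        equiv D E \<and>
        bij_betw g (D // E) A \<and>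
        (\<forall>s xss. length xss = ar s \<longrightarrow> set xss \<subseteq> D \<longrightarrow>
           (ring_sat mul ((!) (concat xss)) (rel_fm s) \<longleftrightarrow>
            rel s (map (\<lambda>xs. g (E `` {xs})) xss))))"

text \<open>
  The structure \<open>\<nat> \<subseteq> R\<close>: the ring \<open>R\<close> (operations given by their graphs) with a unary
  predicate for the subset \<open>\<nat>\<close>.
\<close>

datatype ring_nat_sym = SPlus | STimes | SZero | SOne | SNat

primrec ring_nat_arity :: "ring_nat_sym \<Rightarrow> nat" where
  "ring_nat_arity SPlus = 3"
| "ring_nat_arity STimes = 3"
| "ring_nat_arity SZero = 1"
| "ring_nat_arity SOne = 1"
| "ring_nat_arity SNat = 1"

primrec ring_nat_rel :: "ring_nat_sym \<Rightarrow> 'r::comm_ring_1 list \<Rightarrow> bool" where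
  "ring_nat_rel SPlus xs \<longleftrightarrow> xs ! 0 + xs ! 1 = xs ! 2"
| "ring_nat_rel STimes xs \<longleftrightarrow> xs ! 0 * xs ! 1 = xs ! 2"
| "ring_nat_rel SZero xs \<longleftrightarrow> xs ! 0 = 0"
| "ring_nat_rel SOne xs \<longleftrightarrow> xs ! 0 = 1"
| "ring_nat_rel SNat xs \<longleftrightarrow> xs ! 0 \<in> \<nat>"

end

theory Submission
  imports Defs "HOL-Library.Function_Algebras"
begin

text \<open>
  By Magnus, \<open>L\<close> embeds into noncommutative power series: \<open>L\<close> is spanned by standard brackets of
  Lyndon words, and in the expansion of such a bracket the Lyndon word itself is leading (longest,
  then lexicographically smallest) with coefficient \<open>1\<close>. Distinct Lyndon words do not commute under
  concatenation, so leading words of nonzero elements of \<open>L\<close> multiply in brackets unless they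
  coincide. This gives a degree with: for \<open>b \<noteq> 0\<close> and every \<open>u\<close>, some \<open>u' = c u - d b\<close> with
  \<open>c \<noteq> 0\<close> is \<open>0\<close> or satisfies \<open>deg (u' b) = deg u' + deg b\<close>.

  If \<open>x\<close> is not a natural number, \<open>\<phi>(x, b)\<close> makes \<open>v\<close> divisible by every \<open>b + n\<close>, hence a nonzero
  multiple of \<open>v\<close> divisible by \<open>b (b + 1) \<dots> (b + n)\<close>, whose degree is unbounded. If \<open>x = n\<close>, take
  \<open>v = w b (b + 1) \<dots> (b + n)\<close> with \<open>w\<close> of degree one and not proportional to \<open>b\<close>: divisibility of \<open>v\<close>
  by any other \<open>b + k\<close> would make a nonzero multiple of \<open>w\<close> divisible by \<open>b + k\<close>.

  A scalar \<open>k\<close> is interpreted by the pairs \<open>(a, k a)\<close> with \<open>a \<noteq> 0\<close>. They are the pairs \<open>(a, c)\<close> with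
  \<open>c a = 0\<close> such that every \<open>c x\<close> has the form \<open>a y\<close>, and scalars of different pairs are compared by
  transporting them to a common \<open>z\<close> that commutes with none of the first components.
\<close>

section \<open>Noncommutative power series\<close>

text \<open>
  The Cauchy product, written through the left derivatives \<open>\<lambda>v. f (a # v)\<close>: with this recursion
  associativity is an induction on the word.
\<close>

primrec conv :: "('a list \<Rightarrow> 'r::comm_ring_1) \<Rightarrow> ('a list \<Rightarrow> 'r) \<Rightarrow> 'a list \<Rightarrow> 'r" where
  "conv f g [] = f [] * g []"
| "conv f g (a # w) = f [] * g (a # w) + conv (\<lambda>v. f (a # v)) g w"

lemma conv_add_left: "conv (f + f') g w = conv f g w + conv f' g w"
proof (induction w arbitrary: f f')
  case (Cons a w)
  show ?case
    using Cons.IH[of "\<lambda>v. f (a # v)" "\<lambda>v. f' (a # v)"] by (simp add: plus_fun_def algebra_simps)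
qed (simp add: algebra_simps)

lemma conv_scale_left: "conv (\<lambda>v. c * f v) g w = c * conv f g w"
  by (induction w arbitrary: f) (simp_all add: algebra_simps)

lemma conv_add_right: "conv f (g + g') w = conv f g w + conv f g' w"
  by (induction w arbitrary: f) (simp_all add: algebra_simps)

lemma conv_scale_right: "conv f (\<lambda>v. c * g v) w = c * conv f g w"
  by (induction w arbitrary: f) (simp_all add: algebra_simps)

lemma conv_assoc: "conv (conv f g) h w = conv f (conv g h) w"
proof (induction w arbitrary: f g)
  case (Cons a w)
  have "(\<lambda>v. conv f g (a # v)) = (\<lambda>v. f [] * g (a # v)) + conv (\<lambda>v. f (a # v)) g"
    by (auto simp: plus_fun_def)
  then have "conv (conv f g) h (a # w) = f [] * g [] * h (a # w)
      + (f [] * conv (\<lambda>v. g (a # v)) h w + conv (conv (\<lambda>v. f (a # v)) g) h w)"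
    by (simp add: conv_add_left conv_scale_left)
  then show ?case
    by (simp add: Cons.IH algebra_simps)
qed (simp add: algebra_simps)

lemma conv_nonzero_split: "conv f g w \<noteq> 0 \<Longrightarrow> \<exists>p q. w = p @ q \<and> f p \<noteq> 0 \<and> g q \<noteq> 0"
proof (induction w arbitrary: f)
  case (Cons a w)
  then have "f [] * g (a # w) \<noteq> 0 \<or> conv (\<lambda>v. f (a # v)) g w \<noteq> 0"
    by auto
  then show ?case
  proof
    assume "f [] * g (a # w) \<noteq> 0"
    then show ?thesis
      by (intro exI[of _ "[]"] exI[of _ "a # w"]) auto
  next
    assume "conv (\<lambda>v. f (a # v)) g w \<noteq> 0"
    from Cons.IH[OF this] obtain p q where "w = p @ q" "f (a # p) \<noteq> 0" "g q \<noteq> 0"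
      by blast
    then show ?thesis
      by (intro exI[of _ "a # p"] exI[of _ q]) simp
  qed
qed auto

text \<open>If no other split of the word contributes, a single term of the Cauchy product survives.
  This makes leading coefficients multiply.\<close>

lemma conv_unique_split:
  assumes "\<And>p q. u @ v = p @ q \<Longrightarrow> f p \<noteq> 0 \<Longrightarrow> g q \<noteq> 0 \<Longrightarrow> p = u"
  shows "conv f g (u @ v) = f u * g v"
  using assms
proof (induction u arbitrary: f)
  case Nil
  show ?case
  proof (cases v)
    case (Cons a w)
    have "conv (\<lambda>v. f (a # v)) g w = 0"
    proof (rule ccontr)
      assume "conv (\<lambda>v. f (a # v)) g w \<noteq> 0"
      from conv_nonzero_split[OF this] obtain p q
        where "w = p @ q" "f (a # p) \<noteq> 0" "g q \<noteq> 0"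
        by blast
      with Nil[of "a # p" q] Cons show False
        by simp
    qed
    with Cons show ?thesis
      by simp
  qed simp
next
  case (Cons a u)
  have "f [] * g (a # u @ v) = 0"
    using Cons.prems[of "[]" "a # u @ v"] by (cases "f [] = 0"; cases "g (a # u @ v) = 0") auto
  moreover have "conv (\<lambda>v. f (a # v)) g (u @ v) = f (a # u) * g v"
  proof (rule Cons.IH)
    show "p = u" if "u @ v = p @ q" "f (a # p) \<noteq> 0" "g q \<noteq> 0" for p q
      using Cons.prems[of "a # p" q] that by simp
  qed
  ultimately show ?case
    by simp
qed

definition comm :: "('a list \<Rightarrow> 'r::comm_ring_1) \<Rightarrow> ('a list \<Rightarrow> 'r) \<Rightarrow> 'a list \<Rightarrow> 'r" where
  "comm f g = conv f g - conv g f"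

definition fscale :: "'r::comm_ring_1 \<Rightarrow> ('a \<Rightarrow> 'r) \<Rightarrow> 'a \<Rightarrow> 'r" where
  "fscale c f = (\<lambda>v. c * f v)"

lemma fscale_apply [simp]: "fscale c f v = c * f v"
  by (simp add: fscale_def)

lemma fscale_linear:
  "fscale c (f + g) = fscale c f + fscale c g" "fscale (c + d) f = fscale c f + fscale d f"
  "fscale c (f - g) = fscale c f - fscale c g" "fscale c (fscale d f) = fscale (c * d) f"
  "fscale 1 f = f"
  by (auto simp: fun_eq_iff algebra_simps)

lemma conv_linear:
  "conv (f + f') g = conv f g + conv f' g" "conv f (g + g') = conv f g + conv f g'"
  "conv (f - f') g = conv f g - conv f' g" "conv f (g - g') = conv f g - conv f g'"
  "conv (fscale c f) g = fscale c (conv f g)" "conv f (fscale c g) = fscale c (conv f g)"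
proof -
  show *: "conv (f + f') g = conv f g + conv f' g" "conv f (g + g') = conv f g + conv f g'"
    for f f' g g' :: "'a list \<Rightarrow> 'b"
    by (auto simp: conv_add_left conv_add_right)
  show "conv (f - f') g = conv f g - conv f' g" "conv f (g - g') = conv f g - conv f g'"
    using *(1)[of "f - f'" f' g, symmetric] *(2)[of f "g - g'" g', symmetric]
    by (simp_all add: eq_diff_eq)
qed (auto simp: fscale_def conv_scale_left conv_scale_right)

text \<open>The commutator of an associative product satisfies the Jacobi identity, so series can
  serve as the target of \<open>expansion\<close>.\<close>

interpretation series: lie_algebra fscale comm
proof
  fix f g h :: "'b list \<Rightarrow> 'a" and c d :: 'a
  have assoc: "conv (conv f g) h = conv f (conv g h)" for f g h :: "'b list \<Rightarrow> 'a"
    by (auto simp: conv_assoc)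
  show "comm f (comm g h) + comm g (comm h f) + comm h (comm f g) = 0"
    by (simp add: comm_def conv_linear assoc)
  show "comm (f + g) h = comm f h + comm g h" "comm f (g + h) = comm f g + comm f h"
    by (simp_all add: comm_def conv_linear)
  show "comm (fscale c f) g = fscale c (comm f g)" "comm f (fscale c g) = fscale c (comm f g)"
    by (simp_all add: comm_def conv_linear fscale_linear)
qed (simp_all add: comm_def fscale_linear)

section \<open>Lyndon words and leading words\<close>

locale ordered_letters =
  fixes r :: "'a rel"
  assumes strict_linear: "strict_linear_order r"
begin

abbreviation lexlt :: "'a list \<Rightarrow> 'a list \<Rightarrow> bool" (infix "\<prec>" 50) where
  "u \<prec> v \<equiv> (u, v) \<in> lexord r"

lemma letters: "trans r" "irrefl r" "total r"
  using strict_linear by (auto simp: strict_linear_order_on_def)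

lemma lexlt_irrefl [simp]: "\<not> u \<prec> u"
  using lexord_irrefl[OF letters(2)] by (auto simp: irrefl_def)

lemma lexlt_trans: "u \<prec> v \<Longrightarrow> v \<prec> w \<Longrightarrow> u \<prec> w"
  using lexord_trans letters(1) by blast

lemma lexlt_total: "u \<prec> v \<or> u = v \<or> v \<prec> u"
  using total_lexord[OF letters(3)] by (auto simp: total_on_def)

lemma lexlt_append: "s \<noteq> [] \<Longrightarrow> u \<prec> u @ s"
  by (cases s) (auto intro: lexord_append_rightI)

lemma lexlt_append_left [simp]: "u @ s \<prec> u @ t \<longleftrightarrow> s \<prec> t"
  using letters(2) by simp

definition lyndon :: "'a list \<Rightarrow> bool" where
  "lyndon w \<longleftrightarrow> w \<noteq> [] \<and> (\<forall>p s. w = p @ s \<longrightarrow> p \<noteq> [] \<longrightarrow> s \<noteq> [] \<longrightarrow> w \<prec> s)"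

lemma lyndonD: "lyndon (p @ s) \<Longrightarrow> p \<noteq> [] \<Longrightarrow> s \<noteq> [] \<Longrightarrow> p @ s \<prec> s"
  by (auto simp: lyndon_def)

text \<open>If \<open>l\<close> is a prefix of \<open>m\<close>, cancelling \<open>l\<close> leaves
  the comparison of \<open>m\<close> with one of its proper suffixes; otherwise the first differing
  letter decides.\<close>

lemma lyndon_append_less:
  assumes "lyndon l" "lyndon m" "l \<prec> m"
  shows "l @ m \<prec> m"
proof -
  from assms(3) consider a v where "m = l @ a # v"
    | u a b v w where "(a, b) \<in> r" "l = u @ a # v" "m = u @ b # w"
    by (auto simp: lexord_def)
  then show ?thesis
  proof cases
    case 1
    moreover from 1 have "m \<prec> a # v"
      using assms(1,2) lyndonD[of l "a # v"] by (auto simp: lyndon_def)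
    ultimately show ?thesis
      by (metis lexlt_append_left)
  next
    case 2
    then show ?thesis
      by (simp add: lexord_append_left_rightI)
  qed
qed

lemma lyndon_append:
  assumes l: "lyndon l" and m: "lyndon m" and lm: "l \<prec> m"
  shows "lyndon (l @ m)"
  unfolding lyndon_def
proof (intro conjI allI impI)
  show "l @ m \<noteq> []"
    using l by (simp add: lyndon_def)
next
  fix p s assume ps: "l @ m = p @ s" "p \<noteq> []" "s \<noteq> []"
  have less: "l @ m \<prec> m"
    by (rule lyndon_append_less) fact+
  from ps(1) consider t where "l = p @ t" "s = t @ m" | t where "p = l @ t" "m = t @ s"
    by (auto simp: append_eq_append_conv2)
  then show "l @ m \<prec> s"
  proof cases
    case 1
    show ?thesis
    proof (cases "t = []")
      case False
      with 1 ps l have "l \<prec> t"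
        using lyndonD by blast
      then show ?thesis
        \<comment> \<open>\<open>t\<close> is no longer than \<open>l\<close>, so
          \<open>l \<prec> t\<close> is decided at a letter and survives appending \<open>m\<close>
          to both.\<close>
        using 1 lexord_sufI[of l t r m m] by simp
    qed (use 1 less in simp)
  next
    case 2
    show ?thesis
    proof (cases "t = []")
      case False
      with 2 ps m have "m \<prec> s"
        using lyndonD by blast
      with less show ?thesis
        using lexlt_trans by blast
    qed (use 2 less in simp)
  qed
qed

definition dominates :: "'a list \<Rightarrow> 'a list \<Rightarrow> bool" where
  "dominates w v \<longleftrightarrow> length v < length w \<or> length v = length w \<and> w \<prec> v"

lemma dominates_trans: "dominates u v \<Longrightarrow> dominates v w \<Longrightarrow> dominates u w"
  unfolding dominates_def using lexlt_trans[of u v w] by auto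

lemma dominates_irrefl [simp]: "\<not> dominates u u"
  by (simp add: dominates_def)

lemma dominates_asym: "dominates u v \<Longrightarrow> \<not> dominates v u"
  using dominates_trans dominates_irrefl by blast

lemma dominates_total: "dominates u v \<or> u = v \<or> dominates v u"
  unfolding dominates_def using lexlt_total[of u v] by auto

text \<open>Plain \<open>\<prec>\<close> is upset by appending when one word is a prefix of the
  other; comparing lengths first makes the order compatible with concatenation on both
  sides.\<close>

lemma dominates_append:
  assumes "p = u \<or> dominates u p" "q = v \<or> dominates v q" "p \<noteq> u \<or> q \<noteq> v"
  shows "dominates (u @ v) (p @ q)"
proof (cases "length u = length p \<and> length v = length q")
  case True
  then show ?thesis
    using assms by (cases "p = u") (auto simp: dominates_def intro: lexord_sufI)
next
  case False
  then show ?thesis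
    using assms by (auto simp: dominates_def)
qed

text \<open>With \<open>l\<close> the smaller word,
  \<open>l @ m \<prec> m \<prec> m @ l\<close>.\<close>

lemma lyndon_append_noncommute:
  assumes "lyndon u" "lyndon v" "u \<noteq> v"
  shows "u @ v \<noteq> v @ u"
proof -
  have *: "l @ m \<noteq> m @ l" if "lyndon l" "lyndon m" "l \<prec> m" for l m
  proof
    assume "l @ m = m @ l"
    then have "m @ l \<prec> m"
      using lyndon_append_less[OF that] by simp
    moreover have "m \<prec> m @ l"
      using that by (intro lexlt_append) (auto simp: lyndon_def)
    ultimately show False
      using lexlt_trans lexlt_irrefl by blast
  qed
  show ?thesis
    using *[of u v] *[of v u] lexlt_total[of u v] assms by auto
qed

lemma finite_dominating:
  assumes "finite T" "T \<noteq> {}"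
  shows "\<exists>a\<in>T. \<forall>b\<in>T. w b = w a \<or> dominates (w a) (w b)"
  using assms
proof (induction rule: finite_ne_induct)
  case (insert x F)
  then obtain a where a: "a \<in> F" "\<forall>b\<in>F. w b = w a \<or> dominates (w a) (w b)"
    by blast
  show ?case
  proof (cases "dominates (w x) (w a)")
    case True
    then have "w b = w x \<or> dominates (w x) (w b)" if "b \<in> insert x F" for b
      using a(2) that dominates_trans[of "w x" "w a" "w b"] by auto
    then show ?thesis
      by blast
  next
    case False
    then show ?thesis
      using a dominates_total[of "w x" "w a"] by (intro bexI[of _ a]) auto
  qed
qed simp

definition lead :: "('a list \<Rightarrow> 'r::zero) \<Rightarrow> 'a list \<Rightarrow> bool" where
  "lead f w \<longleftrightarrow> f w \<noteq> 0 \<and> (\<forall>v. f v \<noteq> 0 \<longrightarrow> v = w \<or> dominates w v)"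

lemma lead_conv:
  fixes f g :: "'a list \<Rightarrow> 'r::idom"
  assumes "lead f u" "lead g v"
  shows "lead (conv f g) (u @ v)" "conv f g (u @ v) = f u * g v"
proof -
  have dom: "p = u \<and> q = v \<or> dominates (u @ v) (p @ q)" if "f p \<noteq> 0" "g q \<noteq> 0" for p q
    using that assms dominates_append[of p u q v] unfolding lead_def by blast
  show eq: "conv f g (u @ v) = f u * g v"
  proof (rule conv_unique_split)
    show "p = u" if "u @ v = p @ q" "f p \<noteq> 0" "g q \<noteq> 0" for p q
      using dom[OF that(2,3)] that(1) by auto
  qed
  show "lead (conv f g) (u @ v)"
    unfolding lead_def
  proof (intro conjI allI impI)
    show "conv f g (u @ v) \<noteq> 0"
      using assms by (simp add: eq lead_def)
  next
    fix w assume "conv f g w \<noteq> 0"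
    from conv_nonzero_split[OF this] obtain p q where "w = p @ q" "f p \<noteq> 0" "g q \<noteq> 0"
      by blast
    then show "w = u @ v \<or> dominates (u @ v) w"
      using dom by blast
  qed
qed

text \<open>The opposite product leads with the dominated word \<open>v @ u\<close>, so it
  contributes nothing at \<open>u @ v\<close>.\<close>

lemma lead_comm:
  fixes f g :: "'a list \<Rightarrow> 'r::idom"
  assumes "lead f u" "lead g v" "dominates (u @ v) (v @ u)"
  shows "lead (comm f g) (u @ v)" "comm f g (u @ v) = f u * g v"
proof -
  note fg = lead_conv[OF assms(1,2)] and gf = lead_conv[OF assms(2,1)]
  have z: "conv g f (u @ v) = 0"
    using gf(1) assms(3) dominates_asym[of "u @ v" "v @ u"] unfolding lead_def by auto
  show eq: "comm f g (u @ v) = f u * g v"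
    by (simp add: comm_def z fg)
  show "lead (comm f g) (u @ v)"
    unfolding lead_def
  proof (intro conjI allI impI)
    show "comm f g (u @ v) \<noteq> 0"
      using assms by (simp add: eq lead_def)
  next
    fix w assume "comm f g w \<noteq> 0"
    then have "conv f g w \<noteq> 0 \<or> conv g f w \<noteq> 0"
      by (auto simp: comm_def)
    then show "w = u @ v \<or> dominates (u @ v) w"
      using fg(1) gf(1) dominates_trans[OF assms(3), of w] assms(3) unfolding lead_def by auto
  qed
qed

text \<open>The two products lead with different words and cannot cancel. Only the length is
  claimed, since either order of concatenation may win.\<close>

lemma lead_comm_lyndon:
  fixes f g :: "'a list \<Rightarrow> 'r::idom"
  assumes "lead f u" "lead g v" "lyndon u" "lyndon v" "u \<noteq> v"
  shows "\<exists>w. lead (comm f g) w \<and> length w = length u + length v"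
proof -
  have "comm f g = - comm g f"
    by (simp add: comm_def)
  then have neg: "lead (comm f g) w" if "lead (comm g f) w" for w
    using that by (simp add: lead_def)
  from dominates_total[of "u @ v" "v @ u"] lyndon_append_noncommute[OF assms(3-5)]
  have "dominates (u @ v) (v @ u) \<or> dominates (v @ u) (u @ v)"
    by blast
  then show ?thesis
  proof
    assume "dominates (u @ v) (v @ u)"
    from lead_comm(1)[OF assms(1,2) this] show ?thesis
      by (intro exI[of _ "u @ v"]) simp
  next
    assume "dominates (v @ u) (u @ v)"
    from neg[OF lead_comm(1)[OF assms(2,1) this]] show ?thesis
      by (intro exI[of _ "v @ u"]) simp
  qed
qed

end

section \<open>Spanning by Lyndon brackets\<close>

context lie_algebra
begin

lemma brk_zero [simp]: "brk 0 y = 0" "brk x 0 = 0"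
  using brk_scale_left[of 0 0 y] brk_scale_right[of x 0 0] by simp_all

lemma brk_minus: "brk (- x) y = - brk x y" "brk x (- y) = - brk x y"
  using brk_scale_left[of "- 1" x y] brk_scale_right[of x "- 1" y] by simp_all

lemma brk_diff: "brk (x - x') y = brk x y - brk x' y" "brk x (y - y') = brk x y - brk x y'"
  using brk_add_left[of x "- x'" y] brk_add_right[of x y "- y'"] by (simp_all add: brk_minus)

lemma brk_antisym: "brk x y = - brk y x"
proof -
  have "0 = brk (x + y) (x + y)"
    by (simp only: brk_alternating)
  also have "\<dots> = brk x y + brk y x"
    unfolding brk_add_left brk_add_right by (simp add: brk_alternating)
  finally show ?thesis
    by (simp add: eq_neg_iff_add_eq_0)
qed

lemma jacobi': "brk (brk x y) z = brk x (brk y z) - brk y (brk x z)"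
  using jacobi[of x y z] brk_antisym[of z "brk x y"] brk_antisym[of x z] brk_minus(2)[of y "brk x z"]
  by (simp add: algebra_simps)

lemma brk_span_right:
  assumes "y \<in> span B" "\<And>s. s \<in> B \<Longrightarrow> brk x s \<in> span C"
  shows "brk x y \<in> span C"
  using assms(1)
proof (induction rule: span_induct_alt)
  case (step c s y)
  then show ?case
    using assms(2) by (simp add: brk_add_right brk_scale_right span_add span_scale)
qed (simp add: span_zero)

lemma brk_span_left:
  assumes "y \<in> span B" "\<And>s. s \<in> B \<Longrightarrow> brk s x \<in> span C"
  shows "brk y x \<in> span C"
  unfolding brk_antisym[of y x]
  using assms brk_span_right[of y B x C] brk_antisym span_neg by metis

end

locale lyndon_lie_algebra = lie_algebra scale brk + ordered_letters r
  for scale :: "'r::comm_ring_1 \<Rightarrow> 'l::ab_group_add \<Rightarrow> 'l" and brk and r :: "'l rel"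
begin

definition standard_pair :: "'l list \<Rightarrow> 'l list \<Rightarrow> bool" where
  "standard_pair l m \<longleftrightarrow> l \<prec> m \<and>
     (\<forall>s t. l = s @ t \<longrightarrow> s \<noteq> [] \<longrightarrow> t \<noteq> [] \<longrightarrow> t = m \<or> m \<prec> t)"

text \<open>
  The premises make \<open>m\<close> the smallest proper suffix of \<open>l @ m\<close>, so \<open>l @ m\<close> is the standard
  factorization of a Lyndon word.
\<close>

inductive lyndon_bracket :: "'l list \<Rightarrow> 'l \<Rightarrow> bool" where
  letter: "lyndon_bracket [x] x"
| bracket: "lyndon_bracket l p \<Longrightarrow> lyndon_bracket m q \<Longrightarrow> standard_pair l m \<Longrightarrow>
    lyndon_bracket (l @ m) (brk p q)"

lemma lyndon_bracket_lyndon: "lyndon_bracket w p \<Longrightarrow> lyndon w"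
proof (induction rule: lyndon_bracket.induct)
  case (letter x)
  then show ?case
    by (auto simp: lyndon_def Cons_eq_append_conv)
qed (auto simp: standard_pair_def intro: lyndon_append)

lemma lyndon_nonempty: "lyndon w \<Longrightarrow> w \<noteq> []"
  by (simp add: lyndon_def)

lemma lyndon_bracket_nonempty: "lyndon_bracket w p \<Longrightarrow> w \<noteq> []"
  using lyndon_bracket_lyndon lyndon_nonempty by blast

text \<open>A suffix starting inside \<open>l\<close> is \<open>z @ m\<close>, larger than
  \<open>z\<close>, which standardness puts at or above \<open>m\<close>. For suffixes of
  \<open>m\<close> the Lyndon property suffices.\<close>

lemma smallest_suffix:
  assumes m: "lyndon m" and l: "standard_pair l m" and st: "l @ m = s @ t" "s \<noteq> []" "t \<noteq> []"
  shows "t = m \<or> m \<prec> t"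
proof -
  from st(1) consider z where "l = s @ z" "t = z @ m" | z where "s = l @ z" "m = z @ t"
    by (auto simp: append_eq_append_conv2)
  then show ?thesis
  proof cases
    case 1
    show ?thesis
    proof (cases "z = []")
      case False
      have "z \<prec> z @ m"
        using m by (intro lexlt_append) (auto simp: lyndon_def)
      then show ?thesis
        using 1 l False st(2) lexlt_trans unfolding standard_pair_def by blast
    qed (use 1 in simp)
  next
    case 2
    then show ?thesis
      using m lyndonD[of z t] st(3) by (cases "z = []") auto
  qed
qed

lemma standard_pair_unique:
  assumes "lyndon l" "lyndon m" "lyndon l'" "lyndon m'" "standard_pair l m" "standard_pair l' m'"
    and eq: "l @ m = l' @ m'"
  shows "l = l' \<and> m = m'"
proof -
  have "m' = m \<or> m \<prec> m'"
    using assms lyndon_nonempty by (intro smallest_suffix[of m l l' m']) auto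
  moreover have "m = m' \<or> m' \<prec> m"
    using assms lyndon_nonempty by (intro smallest_suffix[of m' l' l m]) auto
  ultimately have "m = m'"
    using lexlt_trans lexlt_irrefl by blast
  with eq show ?thesis
    by simp
qed

text \<open>The standard factorization is unique. Hence distinct brackets have distinct words, which
  prevents cancellation in \<open>ex_lead\<close>, and equal words give equal factors, whose bracket
  is zero.\<close>

lemma lyndon_bracket_unique: "lyndon_bracket w p \<Longrightarrow> lyndon_bracket w q \<Longrightarrow> p = q"
proof (induction arbitrary: q rule: lyndon_bracket.induct)
  case (letter x)
  from letter show ?case
    by (cases rule: lyndon_bracket.cases)
      (auto simp: append_eq_Cons_conv Cons_eq_append_conv dest: lyndon_bracket_nonempty)
next
  case (bracket l p m q b)
  from bracket.prems show ?case
  proof (cases rule: lyndon_bracket.cases)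
    case letter
    then show ?thesis
      using bracket.hyps(1,2) by (auto simp: append_eq_Cons_conv dest: lyndon_bracket_nonempty)
  next
    case (bracket l' p' m' q')
    then have "l = l' \<and> m = m'"
      using bracket.hyps lyndon_bracket_lyndon
      by (intro standard_pair_unique) (use \<open>standard_pair l m\<close> \<open>lyndon_bracket l p\<close> \<open>lyndon_bracket m q\<close> in blast)+
    with bracket show ?thesis
      using bracket.IH by blast
  qed
qed

text \<open>The length is recorded because rewriting preserves it, and the alphabet because over a
  finite one only finitely many words of bounded length lie below \<open>m\<close>.\<close>

definition brackets_below :: "'l set \<Rightarrow> nat \<Rightarrow> 'l list \<Rightarrow> 'l set" where
  "brackets_below A N m = {s. \<exists>n. lyndon_bracket n s \<and> n \<prec> m \<and> length n = N \<and> set n \<subseteq> A}"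

lemma brackets_below_mono: "n \<prec> m \<Longrightarrow> brackets_below A N n \<subseteq> brackets_below A N m"
  unfolding brackets_below_def using lexlt_trans by blast

definition words_below :: "'l set \<Rightarrow> nat \<Rightarrow> 'l list \<Rightarrow> 'l list set" where
  "words_below A N m = {w. set w \<subseteq> A \<and> length w \<le> N \<and> w \<prec> m}"

text \<open>Turns descent in \<open>\<prec>\<close> into descent of a natural number:
  \<open>n\<close> itself drops out of the set.\<close>

lemma card_words_below:
  assumes "finite A" "n \<prec> m" "set n \<subseteq> A" "length n \<le> N"
  shows "card (words_below A N n) < card (words_below A N m)"
proof (rule psubset_card_mono)
  show "finite (words_below A N m)"
    by (rule finite_subset[OF _ finite_lists_length_le[OF assms(1), of N]])
      (auto simp: words_below_def)
  have "words_below A N n \<subseteq> words_below A N m"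
    unfolding words_below_def using assms(2) lexlt_trans by blast
  moreover have "n \<in> words_below A N m" "n \<notin> words_below A N n"
    using assms by (auto simp: words_below_def)
  ultimately show "words_below A N n \<subset> words_below A N m"
    by blast
qed

text \<open>
  If the pair is not standard, \<open>l\<close> factors as \<open>l' l''\<close> with \<open>l'' \<prec> m\<close>, and the Jacobi identity
  leads to pairs that are shorter or have a smaller maximum. The bound \<open>n \<prec> m\<close> on the
  occurring words is what makes the maximum drop.
\<close>

lemma bracket_in_span:
  assumes "finite A" "lyndon_bracket l p" "lyndon_bracket m q" "l \<prec> m" "set l \<subseteq> A" "set m \<subseteq> A"
  shows "brk p q \<in> span (brackets_below A (length l + length m) m)"
  using assms(2-)
proof (induction "(l, m)" arbitrary: l m p q
    rule: wf_induct_rule[OF wf_measures[of "[\<lambda>(l, m). length l + length m,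
      \<lambda>(l, m). card (words_below A (length l + length m) m)]"]])
  case 1
  note IH = 1(1) and l = \<open>lyndon_bracket l p\<close> and m = \<open>lyndon_bracket m q\<close>
  define N where "N = length l + length m"
  have shorter: "brk p' q' \<in> span (brackets_below A (length l' + length m') m')"
    if "length l' + length m' < N" "lyndon_bracket l' p'" "lyndon_bracket m' q'" "l' \<prec> m'"
      "set l' \<subseteq> A" "set m' \<subseteq> A" for l' m' p' q'
    using IH that by (simp add: N_def)
  \<comment> \<open>Here the total length is again \<open>N\<close>, so the second measure has to
    drop; antisymmetry puts the larger word second, and it lies below \<open>m\<close>.\<close>
  have lower: "brk p' q' \<in> span (brackets_below A N m)"
    if *: "length l' + length m' = N" "lyndon_bracket l' p'" "lyndon_bracket m' q'" "l' \<prec> m"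
      "m' \<prec> m" "set l' \<subseteq> A" "set m' \<subseteq> A" for l' m' p' q'
  proof -
    have **: "brk p' q' \<in> span (brackets_below A N m)"
      if "length l' + length m' = N" "lyndon_bracket l' p'" "lyndon_bracket m' q'" "l' \<prec> m'"
        "m' \<prec> m" "set l' \<subseteq> A" "set m' \<subseteq> A" for l' m' p' q'
    proof -
      have "card (words_below A N m') < card (words_below A N m)"
        using that by (intro card_words_below assms(1)) auto
      then have "brk p' q' \<in> span (brackets_below A N m')"
        using IH[of l' m' p' q'] that by (simp add: N_def)
      then show ?thesis
        using span_mono[OF brackets_below_mono[OF that(5)]] by blast
    qed
    from lexlt_total[of l' m'] show ?thesis
    proof (elim disjE)
      assume "l' \<prec> m'"
      with * show ?thesis
        by (intro **[of l' m']) auto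
    next
      assume "l' = m'"
      with * have "p' = q'"
        using lyndon_bracket_unique by blast
      then show ?thesis
        by (simp add: brk_alternating span_zero)
    next
      assume "m' \<prec> l'"
      with * have "brk q' p' \<in> span (brackets_below A N m)"
        by (intro **[of m' l']) auto
      then show ?thesis
        unfolding brk_antisym[of p' q'] by (rule span_neg)
    qed
  qed
  have "brk p q \<in> span (brackets_below A N m)"
  proof (cases "standard_pair l m")
    case True
    have "l @ m \<prec> m"
      using l m \<open>l \<prec> m\<close> by (intro lyndon_append_less lyndon_bracket_lyndon)
    moreover have "lyndon_bracket (l @ m) (brk p q)"
      using l m True by (rule bracket)
    ultimately have "brk p q \<in> brackets_below A N m"
      using 1(5,6) unfolding brackets_below_def N_def by force
    then show ?thesis
      by (rule span_base)
  next
    case False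
    then obtain s t where st: "l = s @ t" "s \<noteq> []" "t \<noteq> []" "t \<prec> m"
      using \<open>l \<prec> m\<close> lexlt_total unfolding standard_pair_def by blast
    from l show ?thesis
    proof (cases rule: lyndon_bracket.cases)
      case letter
      with st show ?thesis
        by (auto simp: append_eq_Cons_conv Cons_eq_append_conv)
    next
      case (bracket l' p' l'' p'')
      note b1 = \<open>lyndon_bracket l' p'\<close> and b2 = \<open>lyndon_bracket l'' p''\<close>
      have len: "length l' + length l'' + length m = N" "l' \<noteq> []" "l'' \<noteq> []"
        using bracket b1 b2 lyndon_bracket_nonempty by (auto simp: N_def)
      have sub: "set l' \<subseteq> A" "set l'' \<subseteq> A"
        using bracket 1(5) by auto
      \<comment> \<open>The right factor \<open>l''\<close> is the smallest proper suffix of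
        \<open>l\<close>, so it inherits \<open>t \<prec> m\<close>.\<close>
      have "t = l'' \<or> l'' \<prec> t"
        using bracket st smallest_suffix[of l'' l' s t] lyndon_bracket_lyndon by auto
      then have l''m: "l'' \<prec> m"
        using st(4) lexlt_trans by blast
      have l'm: "l' \<prec> m"
        using lexlt_append[OF len(3), of l'] \<open>l \<prec> m\<close> bracket lexlt_trans by blast
      \<comment> \<open>The inner bracket is shorter and becomes a combination of brackets of words
        \<open>n \<prec> m\<close>; the pair \<open>l'\<close>, \<open>n\<close> then has total
        length \<open>N\<close> with both words below \<open>m\<close>, as \<open>lower\<close>
        requires.\<close>
      have "brk p'' q \<in> span (brackets_below A (length l'' + length m) m)"
        using len sub by (intro shorter b2 m l''m 1(6)) auto
      then have "brk p' (brk p'' q) \<in> span (brackets_below A N m)"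
      proof (rule brk_span_right)
        fix u assume "u \<in> brackets_below A (length l'' + length m) m"
        then obtain n where "lyndon_bracket n u" "n \<prec> m" "length n = length l'' + length m"
            "set n \<subseteq> A"
          by (auto simp: brackets_below_def)
        then show "brk p' u \<in> span (brackets_below A N m)"
          using lower[OF _ b1, of n u] len sub l'm by auto
      qed
      moreover have "brk p' q \<in> span (brackets_below A (length l' + length m) m)"
        using len sub by (intro shorter b1 m l'm 1(6)) auto
      then have "brk p'' (brk p' q) \<in> span (brackets_below A N m)"
      proof (rule brk_span_right)
        fix u assume "u \<in> brackets_below A (length l' + length m) m"
        then obtain n where "lyndon_bracket n u" "n \<prec> m" "length n = length l' + length m"
            "set n \<subseteq> A"
          by (auto simp: brackets_below_def)
        then show "brk p'' u \<in> span (brackets_below A N m)"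
          using lower[OF _ b2, of n u] len sub l''m by auto
      qed
      ultimately show ?thesis
        unfolding bracket jacobi' by (rule span_diff)
    qed
  qed
  then show ?case
    by (simp add: N_def)
qed

definition brackets_on :: "'l set \<Rightarrow> 'l set" where
  "brackets_on X = {s. \<exists>n. lyndon_bracket n s \<and> set n \<subseteq> X}"

lemma brackets_on_closed:
  assumes "y \<in> span (brackets_on X)" "z \<in> span (brackets_on X)"
  shows "brk y z \<in> span (brackets_on X)"
proof -
  have less: "brk p q \<in> span (brackets_on X)"
    if "lyndon_bracket l p" "lyndon_bracket m q" "l \<prec> m" "set l \<subseteq> X" "set m \<subseteq> X" for l m p q
  proof -
    \<comment> \<open>\<open>X\<close> may be infinite, so the finite alphabet consists of the
      letters of the two words.\<close>
    have "brackets_below (set l \<union> set m) (length l + length m) m \<subseteq> brackets_on X"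
      using that by (auto simp: brackets_below_def brackets_on_def)
    then show ?thesis
      using bracket_in_span[OF _ that(1-3), of "set l \<union> set m"] span_mono by auto
  qed
  have gens: "brk p q \<in> span (brackets_on X)" if pq: "p \<in> brackets_on X" "q \<in> brackets_on X" for p q
  proof -
    from pq obtain l m where lm: "lyndon_bracket l p" "lyndon_bracket m q" "set l \<subseteq> X" "set m \<subseteq> X"
      unfolding brackets_on_def by blast
    from lexlt_total[of l m] show ?thesis
    proof (elim disjE)
      assume "l \<prec> m"
      from less[OF lm(1,2) this lm(3,4)] show ?thesis .
    next
      assume "l = m"
      with lm have "p = q"
        using lyndon_bracket_unique by blast
      then show ?thesis
        by (simp add: brk_alternating span_zero)
    next
      assume "m \<prec> l"
      from span_neg[OF less[OF lm(2,1) this lm(4,3)]] show ?thesis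
        by (simp add: brk_antisym[of p q])
    qed
  qed
  have "brk y q \<in> span (brackets_on X)" if "q \<in> brackets_on X" for q
    using brk_span_left[OF assms(1) gens[OF _ that]] .
  then show ?thesis
    by (rule brk_span_right[OF assms(2)])
qed

lemma lie_eval_in_span: "lgens t \<subseteq> X \<Longrightarrow> lie_eval scale brk id t \<in> span (brackets_on X)"
proof (induction t)
  case (LGen x)
  moreover have "lyndon_bracket [x] x"
    by (rule letter)
  ultimately have "x \<in> brackets_on X"
    unfolding brackets_on_def by fastforce
  then show ?case
    by (simp add: span_base)
qed (auto intro: span_zero span_add span_scale brackets_on_closed)

end

section \<open>The Magnus expansion and the degree of Lie elements\<close>

locale free_lie_algebra_on = lyndon_lie_algebra scale brk r
  for scale :: "'r::idom \<Rightarrow> 'l::ab_group_add \<Rightarrow> 'l" and brk and r :: "'l rel" +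
  fixes X :: "'l set"
  assumes basis: "free_lie_basis scale brk X"
begin

text \<open>The Magnus map, determined by the universal property of the basis. Its injectivity is a
  consequence of \<open>ex_lead\<close>.\<close>

definition expansion :: "'l \<Rightarrow> 'l list \<Rightarrow> 'r" where
  "expansion = (SOME h. lie_hom scale brk fscale comm h \<and>
     (\<forall>x\<in>X. h x = (\<lambda>w. if w = [x] then 1 else 0)))"

lemma expansion:
  "lie_hom scale brk fscale comm expansion"
  "x \<in> X \<Longrightarrow> expansion x = (\<lambda>w. if w = [x] then 1 else 0)"
proof -
  have "\<exists>h. lie_hom scale brk fscale comm h \<and> (\<forall>x\<in>X. h x = (\<lambda>w. if w = [x] then 1 else 0 :: 'r))"
    using free_lie_basis_universal[OF lie_algebra_axioms series.lie_algebra_axioms basis,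
        of "\<lambda>x w. if w = [x] then 1 else 0"] by blast
  from someI_ex[OF this] show "lie_hom scale brk fscale comm expansion"
    "x \<in> X \<Longrightarrow> expansion x = (\<lambda>w. if w = [x] then 1 else 0)"
    by (simp_all add: expansion_def)
qed

lemma expansion_linear [simp]:
  "expansion (x + y) w = expansion x w + expansion y w"
  "expansion (scale c x) w = c * expansion x w"
  "expansion (brk x y) = comm (expansion x) (expansion y)"
  using expansion(1) by (simp_all add: lie_hom_def)

lemma expansion_zero [simp]: "expansion 0 w = 0"
  using expansion_linear(2)[of 0 0 w] by simp

lemma expansion_diff [simp]: "expansion (x - y) w = expansion x w - expansion y w"
  using expansion_linear(1)[of "x - y" y w] by (simp add: algebra_simps)

lemma expansion_sum [simp]: "expansion (sum f T) w = (\<Sum>a\<in>T. expansion (f a) w)"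
  by (induction T rule: infinite_finite_induct) simp_all

lemma lead_letter:
  assumes "x \<in> X"
  shows "lead (expansion x) [x]" "expansion x [x] = 1"
  using assms by (simp_all add: expansion lead_def)

text \<open>Since \<open>l @ m \<prec> m \<prec> m @ l\<close>, the Lyndon word itself wins in the
  commutator, and the coefficients \<open>1\<close> multiply.\<close>

lemma lead_lyndon_bracket:
  assumes "lyndon_bracket w p" "set w \<subseteq> X"
  shows "lead (expansion p) w \<and> expansion p w = 1"
  using assms
proof induction
  case (letter x)
  then show ?case
    using lead_letter by auto
next
  case (bracket l p m q)
  have "l @ m \<prec> m"
    using bracket lyndon_bracket_lyndon
    by (intro lyndon_append_less) (auto simp: standard_pair_def)
  moreover have "m \<prec> m @ l"
    using bracket lyndon_bracket_nonempty by (intro lexlt_append) auto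
  ultimately have "dominates (l @ m) (m @ l)"
    unfolding dominates_def using lexlt_trans by auto
  then show ?case
    using bracket lead_comm[of "expansion p" l "expansion q" m] by simp
qed

text \<open>In a combination of Lyndon brackets, the dominating one of their words occurs in the
  expansion of only one bracket, so it cannot cancel.\<close>

lemma ex_lead:
  assumes "f \<noteq> 0"
  shows "\<exists>w. lead (expansion f) w \<and> lyndon w"
proof -
  obtain t where "lgens t \<subseteq> X" "lie_eval scale brk id t = f"
    using basis unfolding free_lie_basis_def by blast
  then have "f \<in> span (brackets_on X)"
    using lie_eval_in_span by blast
  then obtain T c where T: "finite T" "T \<subseteq> brackets_on X" "f = (\<Sum>a\<in>T. scale (c a) a)"
    unfolding span_explicit by blast
  \<comment> \<open>Zero coefficients are dropped so that the dominating word is sure to carry a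
    nonzero one.\<close>
  define S where "S = {a \<in> T. c a \<noteq> 0}"
  have S: "finite S" "S \<subseteq> brackets_on X" "f = (\<Sum>a\<in>S. scale (c a) a)"
    using T unfolding S_def by (auto intro!: sum.mono_neutral_right)
  then have "S \<noteq> {}"
    using assms by auto
  from S(2) obtain w where w: "\<And>a. a \<in> S \<Longrightarrow> lyndon_bracket (w a) a \<and> set (w a) \<subseteq> X"
    unfolding brackets_on_def subset_iff mem_Collect_eq by metis
  then have lead_w: "lead (expansion a) (w a)" "expansion a (w a) = 1" if "a \<in> S" for a
    using lead_lyndon_bracket that by auto
  obtain m where m: "m \<in> S" "\<And>b. b \<in> S \<Longrightarrow> w b = w m \<or> dominates (w m) (w b)"
    using finite_dominating[OF S(1) \<open>S \<noteq> {}\<close>, of w] by blast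
  have others: "expansion b (w m) = 0" if b: "b \<in> S" "b \<noteq> m" for b
  proof -
    have "w b \<noteq> w m"
      using w[OF b(1)] w[OF m(1)] b(2) lyndon_bracket_unique by auto
    with m(2)[OF b(1)] have "dominates (w m) (w b)"
      by blast
    then show ?thesis
      using lead_w(1)[OF b(1)] dominates_asym \<open>w b \<noteq> w m\<close> unfolding lead_def by metis
  qed
  have "expansion f (w m) = (\<Sum>b\<in>S. c b * expansion b (w m))"
    by (simp add: S(3))
  also have "\<dots> = (\<Sum>b\<in>{m}. c b * expansion b (w m))"
    using S(1) m(1) others by (intro sum.mono_neutral_right) auto
  finally have "expansion f (w m) = c m"
    using lead_w(2)[OF m(1)] by simp
  moreover have "c m \<noteq> 0"
    using m(1) by (simp add: S_def)
  moreover have "v = w m \<or> dominates (w m) v" if v: "expansion f v \<noteq> 0" for v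
  proof -
    have "expansion f v = (\<Sum>b\<in>S. c b * expansion b v)"
      by (simp add: S(3))
    then obtain b where b: "b \<in> S" "c b * expansion b v \<noteq> 0"
      using v sum.neutral[of S "\<lambda>b. c b * expansion b v"] by auto
    then have "v = w b \<or> dominates (w b) v"
      using lead_w(1)[OF b(1)] unfolding lead_def by auto
    then show ?thesis
      using m(2)[OF b(1)] dominates_trans[of "w m" "w b" v] by auto
  qed
  ultimately have "lead (expansion f) (w m)"
    by (simp add: lead_def)
  then show ?thesis
    using w[OF m(1)] lyndon_bracket_lyndon by blast
qed

definition deg :: "'l \<Rightarrow> nat" where
  "deg f = (LEAST n. \<forall>w. expansion f w \<noteq> 0 \<longrightarrow> length w \<le> n)"

lemma deg_lead:
  assumes "lead (expansion f) w"
  shows "deg f = length w"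
  unfolding deg_def
  using assms by (intro Least_equality) (auto simp: lead_def dominates_def)

lemma deg_zero: "deg 0 = 0"
  unfolding deg_def by (intro Least_equality) auto

lemma length_le_deg:
  assumes "expansion f w \<noteq> 0"
  shows "length w \<le> deg f"
proof -
  obtain v where "lead (expansion f) v"
    using ex_lead[of f] assms by fastforce
  then show ?thesis
    using assms deg_lead[of f v] by (auto simp: lead_def dominates_def)
qed

lemma scale_eq_zero:
  assumes "scale c f = 0"
  shows "c = 0 \<or> f = 0"
proof (rule ccontr)
  assume "\<not> ?thesis"
  then obtain w where "c \<noteq> 0" "expansion f w \<noteq> 0"
    using ex_lead[of f] by (auto simp: lead_def)
  moreover have "c * expansion f w = 0"
    using arg_cong[OF assms, of "\<lambda>g. expansion g w"] by simp
  ultimately show False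
    by simp
qed

lemma deg_pos: "f \<noteq> 0 \<Longrightarrow> 0 < deg f"
  using ex_lead[of f] deg_lead[of f] lyndon_nonempty by auto

lemma deg_add: "deg (f + g) \<le> max (deg f) (deg g)"
  unfolding deg_def[of "f + g"]
proof (intro Least_le allI impI)
  fix w assume "expansion (f + g) w \<noteq> 0"
  then have "expansion f w \<noteq> 0 \<or> expansion g w \<noteq> 0"
    by auto
  then show "length w \<le> max (deg f) (deg g)"
    using length_le_deg by (auto simp: le_max_iff_disj)
qed

lemma deg_scale: "c \<noteq> 0 \<Longrightarrow> deg (scale c f) = deg f"
  unfolding deg_def by simp

text \<open>Degrees add unless \<open>u\<close> and \<open>b\<close> have the same leading word. In
  that case, cross-multiplying by the leading coefficients, without division in the domain, removes
  this word and leaves a different one in the lead.\<close>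

lemma deg_brk_reduced:
  assumes "b \<noteq> 0"
  shows "\<exists>c d. c \<noteq> 0 \<and> (scale c u = scale d b \<or>
           deg (brk (scale c u - scale d b) b) = deg (scale c u - scale d b) + deg b)"
proof -
  obtain v where v: "lead (expansion b) v" "lyndon v"
    using ex_lead assms by blast
  have add: "deg (brk f b) = deg f + deg b"
    if "lead (expansion f) w" "lyndon w" "w \<noteq> v" for f w
    using lead_comm_lyndon[OF that(1) v(1) that(2) v(2) that(3)] that v(1)
    by (auto simp: deg_lead)
  show ?thesis
  proof (cases "u = 0")
    case True
    then show ?thesis
      by (intro exI[of _ 1] exI[of _ 0]) simp
  next
    case False
    then obtain w where w: "lead (expansion u) w" "lyndon w"
      using ex_lead by blast
    show ?thesis
    proof (cases "w = v")
      case False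
      with add w show ?thesis
        by (intro exI[of _ 1] exI[of _ 0]) simp
    next
      case True
      define f where "f = scale (expansion b v) u - scale (expansion u v) b"
      have "deg (brk f b) = deg f + deg b" if f: "f \<noteq> 0"
      proof -
        obtain w' where w': "lead (expansion f) w'" "lyndon w'"
          using ex_lead[OF f] by blast
        moreover have "expansion f v = 0"
          by (simp add: f_def)
        ultimately show ?thesis
          by (intro add) (auto simp: lead_def)
      qed
      moreover have "expansion b v \<noteq> 0"
        using v by (simp add: lead_def)
      ultimately show ?thesis
        by (intro exI[of _ "expansion b v"] exI[of _ "expansion u v"]) (auto simp: f_def)
    qed
  qed
qed

text \<open>Bracketing \<open>y\<close> with \<open>x\<close> repeatedly gives elements with leading
  coefficient \<open>1\<close> at arbitrarily long words; the functional reads off that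
  coefficient.\<close>

lemma ex_separated:
  assumes "x \<in> X" "y \<in> X" "(x, y) \<in> r" "finite F"
  shows "\<exists>z f. module_hom scale (*) f \<and> f z = 1 \<and> (\<forall>a\<in>F. f a = 0)"
proof -
  define z where "z n = (brk x ^^ n) y" for n
  define w where "w n = replicate n x @ [y]" for n
  have z: "lead (expansion (z n)) (w n) \<and> expansion (z n) (w n) = 1" for n
  proof (induction n)
    case 0
    then show ?case
      using lead_letter[OF assms(2)] by (simp add: z_def w_def)
  next
    case (Suc n)
    \<comment> \<open>Past the common \<open>n\<close> letters \<open>x\<close>, the two words
      compare \<open>x\<close> with \<open>y\<close>; this is where \<open>(x, y) \<in> r\<close>
      enters.\<close>
    have "x # replicate n x @ [y] = replicate n x @ x # [y]"
      by (simp only: replicate_app_Cons_same)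
    then have "x # replicate n x @ [y] \<prec> replicate n x @ y # [x]"
      using lexord_append_left_rightI[OF assms(3)] by metis
    then have "dominates ([x] @ w n) (w n @ [x])"
      by (simp add: dominates_def w_def)
    from lead_comm[OF lead_letter(1)[OF assms(1)] conjunct1[OF Suc.IH] this]
    show ?case
      using Suc.IH lead_letter(2)[OF assms(1)] by (simp add: z_def w_def)
  qed
  \<comment> \<open>\<open>w n\<close> has length \<open>n + 1\<close>, beyond every degree in
    \<open>F\<close>.\<close>
  define n where "n = Max (deg ` F)"
  have "expansion a (w n) = 0" if "a \<in> F" for a
  proof (rule ccontr)
    assume "expansion a (w n) \<noteq> 0"
    then have "length (w n) \<le> deg a"
      by (rule length_le_deg)
    also have "deg a \<le> n"
      using assms(4) that by (simp add: n_def)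
    finally show False
      by (simp add: w_def)
  qed
  moreover have "module_hom scale (*) (\<lambda>f. expansion f (w n))"
    by (simp add: module_hom_iff module_axioms module_def algebra_simps)
  ultimately show ?thesis
    using z by blast
qed

text \<open>One of two generators will do: if both were proportional to \<open>b\<close>,
  cross-multiplying would relate them, although their expansions share no word.\<close>

lemma ex_deg_one_independent:
  assumes "x \<in> X" "y \<in> X" "x \<noteq> y"
  shows "\<exists>w. deg w \<le> 1 \<and> (\<forall>c d. scale c w = scale d b \<longrightarrow> c = 0)"
proof (rule ccontr)
  assume contr: "\<not> ?thesis"
  have "deg x = 1" "deg y = 1"
    using deg_lead lead_letter(1) assms by fastforce+
  with contr obtain c d c' d' where eq: "scale c x = scale d b" "c \<noteq> 0"
      "scale c' y = scale d' b" "c' \<noteq> 0"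
    by (metis order_refl)
  have "scale (d' * c) x = scale (d * c') y"
    using arg_cong[OF eq(1), of "scale d'"] arg_cong[OF eq(3), of "scale d"]
    by (simp add: mult.commute)
  then have e: "d' * c * expansion x v = d * c' * expansion y v" for v
    by (metis expansion_linear(2))
  have "d' * c = 0"
    using e[of "[x]"] assms by (simp add: expansion)
  moreover have "d * c' = 0"
    using e[of "[y]"] assms by (simp add: expansion)
  ultimately have "scale c x = 0"
    using eq by auto
  then have "c * expansion x [x] = 0"
    by (metis expansion_linear(2) expansion_zero)
  then show False
    using eq(2) lead_letter(2)[OF assms(1)] by simp
qed

end

text \<open>Over at most one generator every expression is a multiple of a single element, and such
  multiples commute.\<close>

lemma (in lie_algebra) free_lie_basis_two_elements:
  assumes "free_lie_basis scale brk X" "brk u v \<noteq> 0"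
  shows "\<exists>x\<in>X. \<exists>y\<in>X. x \<noteq> y"
proof (rule ccontr)
  assume "\<not> ?thesis"
  then obtain x where x: "X \<subseteq> {x}"
    by (cases "X = {}") auto
  have "\<exists>c. lie_eval scale brk id t = scale c x" if "lgens t \<subseteq> X" for t
    using that
  proof (induction t)
    case (LGen y)
    then show ?case
      using x by (intro exI[of _ 1]) auto
  next
    case LZero
    show ?case
      by (intro exI[of _ 0]) simp
  next
    case (LAdd s t)
    then obtain c d where "lie_eval scale brk id s = scale c x" "lie_eval scale brk id t = scale d x"
      by (metis Un_subset_iff lie_term.set(3,5))
    then have "lie_eval scale brk id (LAdd s t) = scale (c + d) x"
      by (simp only: lie_eval.simps scale_left_distrib)
    then show ?case ..
  next
    case (LScale c t)
    then show ?case
      by auto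
  next
    case (LBrk s t)
    then obtain c d where "lie_eval scale brk id s = scale c x" "lie_eval scale brk id t = scale d x"
      by (metis Un_subset_iff lie_term.set(3,5))
    then have "lie_eval scale brk id (LBrk s t) = scale 0 x"
      by (simp only: lie_eval.simps brk_scale_left brk_scale_right brk_alternating
          scale_zero_right scale_zero_left)
    then show ?case ..
  qed
  then obtain c d where "u = scale c x" "v = scale d x"
    using assms(1) unfolding free_lie_basis_def by metis
  then show False
    using assms(2) by (simp add: brk_scale_left brk_scale_right brk_alternating)
qed

section \<open>Divisibility by shifted elements\<close>

text \<open>Collects what the later arguments take from freeness, with no reference to words.
  \<open>deg_brk_reduced\<close> replaces additivity of the degree, which fails already for
  \<open>brk b b\<close>.\<close>

locale lie_algebra_with_degree = lie_algebra scale brk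
  for scale :: "'r::{idom, ring_char_0} \<Rightarrow> 'l::ab_group_add \<Rightarrow> 'l" and brk +
  fixes deg :: "'l \<Rightarrow> nat"
  assumes torsion_free: "scale c x = 0 \<Longrightarrow> c = 0 \<or> x = 0"
    and deg_zero: "deg 0 = 0"
    and deg_pos: "x \<noteq> 0 \<Longrightarrow> 0 < deg x"
    and deg_add: "deg (x + y) \<le> max (deg x) (deg y)"
    and deg_scale: "c \<noteq> 0 \<Longrightarrow> deg (scale c x) = deg x"
    and deg_brk_reduced: "b \<noteq> 0 \<Longrightarrow> \<exists>c d. c \<noteq> 0 \<and> (scale c u = scale d b \<or>
           deg (brk (scale c u - scale d b) b) = deg (scale c u - scale d b) + deg b)"
    and ex_separated: "finite F \<Longrightarrow> \<exists>z f. module_hom scale (*) f \<and> f z = 1 \<and> (\<forall>a\<in>F. f a = 0)"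
    and ex_deg_one_independent: "\<exists>w. deg w \<le> 1 \<and> (\<forall>c d. scale c w = scale d b \<longrightarrow> c = 0)"
begin

lemma deg_scale_le: "deg (scale c x) \<le> deg x"
  by (cases "c = 0") (simp_all add: deg_zero deg_scale)

lemma deg_diff: "deg (x - y) \<le> max (deg x) (deg y)"
  using deg_add[of x "scale (- 1) y"] deg_scale[of "- 1" y] by simp

text \<open>The reduced element still commutes with \<open>b\<close>; if the degrees added, the zero
  bracket would have positive degree.\<close>

lemma centralizer:
  assumes "b \<noteq> 0" "brk u b = 0"
  shows "\<exists>c d. c \<noteq> 0 \<and> scale c u = scale d b"
proof -
  obtain c d where cd: "c \<noteq> 0" "scale c u = scale d b \<or>
      deg (brk (scale c u - scale d b) b) = deg (scale c u - scale d b) + deg b"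
    using deg_brk_reduced assms(1) by blast
  have "brk (scale c u - scale d b) b = 0"
    by (simp add: brk_diff brk_scale_left brk_alternating assms(2))
  then show ?thesis
    using cd deg_zero deg_pos[OF assms(1)] by auto
qed

abbreviation shift :: "'l \<Rightarrow> 'l \<Rightarrow> 'r \<Rightarrow> 'l" where
  "shift \<equiv> brk_shift scale brk"

lemma shift_linear:
  "shift (u + v) b k = shift u b k + shift v b k"
  "shift (u - v) b k = shift u b k - shift v b k"
  "shift (scale c u) b k = scale c (shift u b k)"
  by (simp_all add: brk_shift_def brk_add_left brk_diff brk_scale_left scale_right_distrib
      scale_right_diff_distrib mult.commute)

text \<open>All shifts are polynomials in the single operator that brackets with \<open>b\<close> on
  the right.\<close>

lemma shift_commute: "shift (shift u b k) b j = shift (shift u b j) b k"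
  by (simp add: brk_shift_def brk_add_left brk_scale_left scale_right_distrib mult.commute)

lemma shift_change: "shift u b j = shift u b k + scale (j - k) u"
  by (simp add: brk_shift_def scale_left_diff_distrib)

text \<open>Modulo \<open>b + k\<close> the factor \<open>b + j\<close> acts as the scalar
  \<open>j - k\<close>, so it can be stripped at the cost of that scalar.\<close>

lemma shift_change_multiple:
  assumes "scale c (shift t b j) = shift u b k"
  shows "scale (c * (j - k)) t = shift (u - scale c t) b k"
proof -
  have "scale c (shift t b k) + scale (c * (j - k)) t = shift u b k"
    using assms unfolding shift_change[of t b j k] by (simp add: scale_right_distrib)
  then show ?thesis
    by (simp add: shift_linear algebra_simps)
qed

lemma shift_zero [simp]: "shift 0 b k = 0"
  by (simp add: brk_shift_def)

text \<open>As \<open>deg b < deg u\<close>, reduction by \<open>b\<close> does not lower the degree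
  of \<open>u\<close>. So \<open>brk u b\<close> has degree at least \<open>deg u + deg b\<close>,
  which \<open>scale k u\<close> cannot cancel.\<close>

lemma deg_shift:
  assumes "b \<noteq> 0" "deg b < deg u"
  shows "deg u < deg (shift u b k)"
proof -
  obtain c d where cd: "c \<noteq> 0" "scale c u = scale d b \<or>
      deg (brk (scale c u - scale d b) b) = deg (scale c u - scale d b) + deg b"
    using deg_brk_reduced assms(1) by blast
  define f where "f = scale c u - scale d b"
  have "deg u = deg (f + scale d b)"
    using cd(1) by (simp add: f_def deg_scale)
  also have "\<dots> \<le> max (deg f) (deg b)"
    using deg_add[of f "scale d b"] deg_scale_le[of d b] by auto
  finally have f: "deg u \<le> deg f"
    using assms(2) by auto
  then have "scale c u \<noteq> scale d b"
    using assms(2) deg_zero f_def by auto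
  then have "deg (brk f b) = deg f + deg b"
    using cd(2) by (simp add: f_def)
  moreover have "brk f b = scale c (brk u b)"
    by (simp add: f_def brk_diff brk_scale_left brk_alternating)
  ultimately have "deg u + deg b \<le> deg (brk u b)"
    using f cd(1) by (simp add: deg_scale)
  moreover have "brk u b = shift u b k - scale k u"
    by (simp add: brk_shift_def)
  then have "deg (brk u b) \<le> max (deg (shift u b k)) (deg u)"
    using deg_diff[of "shift u b k" "scale k u"] deg_scale_le[of k u] by auto
  ultimately show ?thesis
    using deg_pos[OF assms(1)] by auto
qed

text \<open>Starts the induction in \<open>deg_shifts\<close>, where \<open>w\<close> may have small
  degree and \<open>deg_shift\<close> does not apply.\<close>

lemma deg_brk:
  assumes "brk w b \<noteq> 0"
  shows "deg b < deg (brk w b)"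
proof -
  have b: "b \<noteq> 0"
    using assms by auto
  obtain c d where cd: "c \<noteq> 0" "scale c w = scale d b \<or>
      deg (brk (scale c w - scale d b) b) = deg (scale c w - scale d b) + deg b"
    using deg_brk_reduced b by blast
  have eq: "brk (scale c w - scale d b) b = scale c (brk w b)"
    by (simp add: brk_diff brk_scale_left brk_alternating)
  moreover have "scale c (brk w b) \<noteq> 0"
    using torsion_free assms cd(1) by blast
  ultimately have "scale c w - scale d b \<noteq> 0"
    by auto
  with cd deg_pos[OF this] show ?thesis
    by (simp add: eq deg_scale)
qed

text \<open>\<open>shifts u b k n\<close> is \<open>u (b + k) (b + k + 1) \<dots> (b + k + n)\<close>.\<close>

primrec shifts :: "'l \<Rightarrow> 'l \<Rightarrow> nat \<Rightarrow> nat \<Rightarrow> 'l" where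
  "shifts u b k 0 = shift u b (of_nat k)"
| "shifts u b k (Suc n) = shift (shifts u b k n) b (of_nat (k + Suc n))"

lemma shifts_diff: "shifts (u - v) b k n = shifts u b k n - shifts v b k n"
  by (induction n) (simp_all add: shift_linear)

lemma shifts_front: "shifts u b k (Suc n) = shift (shifts u b (Suc k) n) b (of_nat k)"
proof (induction n)
  case 0
  show ?case
    by (simp add: shift_commute[of _ _ "of_nat k"])
next
  case (Suc n)
  then show ?case
    by (simp add: shift_commute[of _ _ "of_nat k"])
qed

lemma shifts_divisible:
  assumes "i \<le> n"
  shows "\<exists>u. shifts w b 0 n = shift u b (of_nat i)"
  using assms
proof (induction n)
  case 0
  then show ?case
    by auto
next
  case (Suc n)
  show ?case
  proof (cases "i = Suc n")
    case True
    then show ?thesis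
      by auto
  next
    case False
    with Suc obtain u where "shifts w b 0 n = shift u b (of_nat i)"
      by auto
    then show ?thesis
      by (auto simp: shift_commute[of u b "of_nat i"])
  qed
qed

lemma deg_shifts:
  assumes "brk w b \<noteq> 0"
  shows "deg b + n < deg (shifts w b 0 n)"
proof (induction n)
  case 0
  show ?case
    using deg_brk[OF assms] by (simp add: brk_shift_def)
next
  case (Suc n)
  have "b \<noteq> 0"
    using assms by auto
  then show ?case
    using Suc deg_shift[of b "shifts w b 0 n" "of_nat (Suc n)"] by simp
qed

text \<open>
  Taking differences of the quotients \<open>v / (b + k)\<close> mimics
  \<open>j! / (k (k + 1) \<dots> (k + j)) = (j - 1)! / (k \<dots> (k + j - 1)) - (j - 1)! / ((k + 1) \<dots> (k + j))\<close>.
\<close>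

lemma fact_multiple_of_shifts:
  assumes "\<And>n. shift (us n) b (of_nat n) = v"
  shows "\<exists>w. shifts w b k j = scale (fact j) v"
proof (induction j arbitrary: k)
  case 0
  then show ?case
    using assms by auto
next
  case (Suc j)
  from Suc obtain y z where y: "shifts y b k j = scale (fact j) v"
    and z: "shifts z b (Suc k) j = scale (fact j) v"
    by blast
  \<comment> \<open>The product for \<open>y\<close> lacks the last factor and that for
    \<open>z\<close> the first; the missing factors differ by the scalar
    \<open>j + 1\<close>.\<close>
  have "shifts (y - z) b k (Suc j) =
      shift (scale (fact j) v) b (of_nat (k + Suc j)) - shift (scale (fact j) v) b (of_nat k)"
    unfolding shifts_diff shifts_front[of z] by (simp add: y z)
  also have "\<dots> = scale (of_nat (Suc j)) (scale (fact j) v)"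
    by (subst shift_change[of _ _ _ "of_nat k"]) simp
  also have "\<dots> = scale (fact (Suc j)) v"
    by simp
  finally show ?case
    by blast
qed

text \<open>Otherwise a factorial multiple of \<open>v\<close>, nonzero in characteristic
  \<open>0\<close>, would be a product of \<open>deg v + 1\<close> shifts, whose degree exceeds
  \<open>deg v\<close>.\<close>

lemma not_all_shifts_divide:
  assumes "v \<noteq> 0"
  shows "\<exists>n. \<forall>u. shift u b (of_nat n) \<noteq> v"
proof (rule ccontr)
  assume "\<not> ?thesis"
  then obtain us where us: "\<And>n. shift (us n) b (of_nat n) = v"
    by metis
  from fact_multiple_of_shifts[OF us]
  obtain w where w: "shifts w b 0 (deg v) = scale (fact (deg v)) v"
    by blast
  have "shifts w b 0 n = 0" if "brk w b = 0" for n
    using that by (induction n) (simp_all add: brk_shift_def)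
  moreover have "scale (fact (deg v)) v \<noteq> 0"
    using torsion_free[of "fact (deg v)" v] assms by auto
  ultimately have "brk w b \<noteq> 0"
    using w by metis
  from deg_shifts[OF this, of "deg v"] show False
    by (simp add: w deg_scale)
qed

text \<open>After reducing \<open>u\<close> to \<open>f\<close>, the degree of
  \<open>brk f b\<close> would be \<open>deg f + deg b\<close>, yet it is at most the maximum of
  \<open>1\<close>, \<open>deg b\<close> and \<open>deg f\<close>. Hence \<open>f = 0\<close>, which
  makes \<open>w\<close> proportional to \<open>b\<close>.\<close>

lemma independent_not_shift:
  assumes "deg w \<le> 1" "\<forall>c d. scale c w = scale d b \<longrightarrow> c = 0" "b \<noteq> 0"
    and c: "c \<noteq> 0" and eq: "scale c w = shift u b k"
  shows False
proof -
  obtain c' d where cd: "c' \<noteq> 0" "scale c' u = scale d b \<or>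
      deg (brk (scale c' u - scale d b) b) = deg (scale c' u - scale d b) + deg b"
    using deg_brk_reduced assms(3) by blast
  define f where "f = scale c' u - scale d b"
  have f: "shift f b k = scale (c' * c) w - scale (k * d) b"
    by (simp add: f_def shift_linear eq[symmetric])
      (simp add: brk_shift_def brk_alternating mult.commute)
  show False
  proof (cases "f = 0")
    case True
    with f have "scale (c' * c) w = scale (k * d) b"
      by simp
    then show False
      using assms(2) c cd(1) mult_eq_0_iff by metis
  next
    case False
    then have deg_f: "deg (brk f b) = deg f + deg b"
      using cd(2) by (auto simp: f_def)
    have eq': "brk f b = (scale (c' * c) w - scale (k * d) b) - scale k f"
      unfolding f[symmetric] by (simp add: brk_shift_def)
    have "deg (brk f b) \<le> max (max 1 (deg b)) (deg f)"
      unfolding eq'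
      using deg_diff[of "scale (c' * c) w - scale (k * d) b" "scale k f"]
        deg_diff[of "scale (c' * c) w" "scale (k * d) b"]
        deg_scale_le[of "c' * c" w] deg_scale_le[of "k * d" b] deg_scale_le[of k f] assms(1)
      by arith
    then show False
      using deg_f deg_pos[OF False] deg_pos[OF assms(3)] by linarith
  qed
qed

text \<open>The factors \<open>b + i\<close> are stripped one by one, at the cost of nonzero scalars
  \<open>i - k\<close>, until \<open>independent_not_shift\<close> applies to
  \<open>w\<close>.\<close>

lemma shifts_not_divisible:
  assumes w: "deg w \<le> 1" "\<forall>c d. scale c w = scale d b \<longrightarrow> c = 0" "b \<noteq> 0"
    and "c \<noteq> 0" "scale c (shifts w b 0 n) = shift u b k" "\<And>i. i \<le> n \<Longrightarrow> k \<noteq> of_nat i"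
  shows False
  using assms(4-)
proof (induction n arbitrary: c u)
  case 0
  have "scale (c * (0 - k)) w = shift (u - scale c w) b k"
    using 0(2) by (intro shift_change_multiple) simp
  moreover have "c * (0 - k) \<noteq> 0"
    using 0(1) 0(3)[of 0] by simp
  ultimately show False
    using independent_not_shift[OF w] by blast
next
  case (Suc n)
  define t where "t = shifts w b 0 n"
  have "scale (c * (of_nat (Suc n) - k)) t = shift (u - scale c t) b k"
    using Suc(3) by (intro shift_change_multiple) (simp add: t_def)
  moreover have "c * (of_nat (Suc n) - k) \<noteq> 0"
    using Suc.prems(1) Suc.prems(3)[of "Suc n"] by simp
  ultimately show False
    using Suc.IH Suc.prems(3) unfolding t_def by (metis le_SucI)
qed

theorem phi_iff:
  assumes b: "b \<noteq> 0"
  shows "phi scale brk x b \<longleftrightarrow> x \<in> \<nat>"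
proof
  assume "phi scale brk x b"
  then obtain u v where v: "v \<noteq> 0" "v = brk u b"
    and step: "\<And>k u1. v = shift u1 b k \<Longrightarrow> \<exists>u2. v = shift u2 b (k + 1) \<or> k = x"
    unfolding phi_def by meson
  show "x \<in> \<nat>"
  proof (rule ccontr)
    assume x: "x \<notin> \<nat>"
    \<comment> \<open>The exit \<open>k = x\<close> never occurs at a natural number, so
      divisibility spreads from \<open>b + 0\<close> to every \<open>b + n\<close>.\<close>
    have "\<exists>u. v = shift u b (of_nat n)" for n
    proof (induction n)
      case 0
      show ?case
        using v(2) by (intro exI[of _ u]) (simp add: brk_shift_def)
    next
      case (Suc n)
      then obtain u1 where "v = shift u1 b (of_nat n)"
        by blast
      from step[OF this] x show ?case
        by (auto simp: add.commute)
    qed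
    then show False
      using not_all_shifts_divide[OF v(1)] by metis
  qed
next
  assume "x \<in> \<nat>"
  then obtain n where x: "x = of_nat n"
    by (auto elim: Nats_cases)
  obtain w where w: "deg w \<le> 1" "\<forall>c d. scale c w = scale d b \<longrightarrow> c = 0"
    using ex_deg_one_independent by blast
  define v where "v = shifts w b 0 n"
  have "brk w b \<noteq> 0"
    using centralizer[OF b, of w] w(2) by auto
  then have v0: "v \<noteq> 0"
    using deg_shifts[of w b n] deg_zero by (auto simp: v_def)
  obtain u where u: "v = brk u b"
    using shifts_divisible[of 0 n w b] by (auto simp: v_def brk_shift_def)
  \<comment> \<open>Only \<open>k\<close> among \<open>0, ..., n\<close> can occur; below
    \<open>n\<close> the next factor also divides \<open>v\<close>, and \<open>n\<close> is the
    exit.\<close>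
  have "\<exists>u2. v = shift u2 b (k + 1) \<or> k = x" if k: "v = shift u1 b k" for k u1
  proof -
    have "scale 1 (shifts w b 0 n) = shift u1 b k"
      using k by (simp add: v_def)
    from shifts_not_divisible[OF w b _ this] obtain i where i: "i \<le> n" "k = of_nat i"
      using zero_neq_one by metis
    show ?thesis
    proof (cases "i = n")
      case False
      with i have "Suc i \<le> n"
        by simp
      from shifts_divisible[OF this, of w b] show ?thesis
        using i by (auto simp: v_def add.commute)
    qed (use i x in auto)
  qed
  with v0 u show "phi scale brk x b"
    unfolding phi_def by blast
qed

end

section \<open>Interpreting the scalars\<close>

definition scalar_pair :: "('l::ab_group_add \<Rightarrow> 'l \<Rightarrow> 'l) \<Rightarrow> 'l \<Rightarrow> 'l \<Rightarrow> bool" where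
  "scalar_pair mul a c \<longleftrightarrow> a \<noteq> 0 \<and> mul c a = 0 \<and> (\<forall>x. \<exists>y. mul c x = mul a y)"

definition transported :: "('l::ab_group_add \<Rightarrow> 'l \<Rightarrow> 'l) \<Rightarrow> 'l \<Rightarrow> 'l \<Rightarrow> 'l \<Rightarrow> 'l \<Rightarrow> bool" where
  "transported mul a c z d \<longleftrightarrow> mul a z \<noteq> 0 \<and> mul c z = mul a d \<and> mul d z = 0"

definition same_scalar :: "('l::ab_group_add \<Rightarrow> 'l \<Rightarrow> 'l) \<Rightarrow> 'l \<Rightarrow> 'l \<Rightarrow> 'l \<Rightarrow> 'l \<Rightarrow> bool" where
  "same_scalar mul a c a' c' \<longleftrightarrow> (\<exists>z d. transported mul a c z d \<and> transported mul a' c' z d)"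

context lie_algebra_with_degree
begin

lemma scale_cancel: "x \<noteq> 0 \<Longrightarrow> scale c x = scale d x \<longleftrightarrow> c = d"
  using torsion_free[of "c - d" x] by (auto simp: scale_left_diff_distrib)

lemma scale_cancel_left: "c \<noteq> 0 \<Longrightarrow> scale c x = scale c y \<longleftrightarrow> x = y"
  using torsion_free[of c "x - y"] by (auto simp: scale_right_diff_distrib)

text \<open>
  A pair satisfying the formula has \<open>q c = p a\<close> with \<open>q \<noteq> 0\<close>; testing on an \<open>x\<close> with a coordinate
  functional that kills \<open>a\<close> shows that \<open>q\<close> divides \<open>p\<close>.
\<close>

lemma scalar_pair_iff: "scalar_pair brk a c \<longleftrightarrow> a \<noteq> 0 \<and> (\<exists>k. c = scale k a)"
proof
  assume "scalar_pair brk a c"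
  then have a: "a \<noteq> 0" and ca: "brk c a = 0" and div: "\<And>x. \<exists>y. brk c x = brk a y"
    by (auto simp: scalar_pair_def)
  obtain q p where qp: "q \<noteq> 0" "scale q c = scale p a"
    using centralizer[OF a ca] by blast
  obtain x f where f: "module_hom scale (*) f" "f x = 1" "f a = 0"
    using ex_separated[of "{a}"] by auto
  note f_lin = module_hom.add[OF f(1)] module_hom.scale[OF f(1)] module_hom.diff[OF f(1)]
  obtain y where y: "brk c x = brk a y"
    using div by blast
  have "brk (scale q y - scale p x) a = brk (scale p a) x - scale q (brk a y)"
    using brk_antisym[of y a] brk_antisym[of x a] by (simp add: brk_diff brk_scale_left)
  also have "\<dots> = 0"
    by (simp add: qp(2)[symmetric] brk_scale_left y)
  finally obtain s t where st: "s \<noteq> 0" "scale s (scale q y - scale p x) = scale t a"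
    using centralizer[OF a] by blast
  have "s * (q * f y - p) = 0"
    using arg_cong[OF st(2), of f] by (simp add: f_lin f(2,3) del: scale_scale)
  then have "p = q * f y"
    using st(1) by simp
  then have "scale q c = scale q (scale (f y) a)"
    using qp(2) by simp
  then have "c = scale (f y) a"
    using scale_cancel_left[OF qp(1)] by blast
  with a show "a \<noteq> 0 \<and> (\<exists>k. c = scale k a)"
    by blast
next
  assume "a \<noteq> 0 \<and> (\<exists>k. c = scale k a)"
  then show "scalar_pair brk a c"
    by (auto simp: scalar_pair_def brk_scale_left brk_alternating brk_scale_right[symmetric])
qed

text \<open>The last condition makes \<open>d\<close> proportional to \<open>z\<close>; bracketing
  with \<open>a\<close>, where \<open>brk a z \<noteq> 0\<close>, fixes the factor as
  \<open>k\<close>.\<close>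

lemma transported_iff:
  "transported brk a (scale k a) z d \<longleftrightarrow> brk a z \<noteq> 0 \<and> d = scale k z"
proof
  assume "transported brk a (scale k a) z d"
  then have az: "brk a z \<noteq> 0" and d: "scale k (brk a z) = brk a d" and dz: "brk d z = 0"
    by (auto simp: transported_def brk_scale_left)
  then have "z \<noteq> 0"
    by auto
  then obtain s t where st: "s \<noteq> 0" "scale s d = scale t z"
    using centralizer dz by blast
  have "scale (s * k) (brk a z) = scale t (brk a z)"
    using d st(2) by (metis brk_scale_right scale_scale)
  then have "s * k = t"
    using scale_cancel[OF az] by blast
  then have "scale s d = scale s (scale k z)"
    using st(2) by simp
  then show "brk a z \<noteq> 0 \<and> d = scale k z"
    using az scale_cancel_left[OF st(1)] by blast
qed (auto simp: transported_def brk_scale_left brk_scale_right brk_alternating)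

text \<open>By \<open>centralizer\<close>, commuting with \<open>a\<close> would make
  \<open>z\<close> proportional to \<open>a\<close>, against a functional that kills
  \<open>a\<close> but not \<open>z\<close>.\<close>

lemma ex_noncommuting:
  assumes "finite F" "0 \<notin> F"
  shows "\<exists>z. \<forall>a\<in>F. brk a z \<noteq> 0"
proof -
  obtain z f where f: "module_hom scale (*) f" "f z = 1" "\<forall>a\<in>F. f a = 0"
    using ex_separated[OF assms(1)] by blast
  have "brk a z \<noteq> 0" if a: "a \<in> F" for a
  proof
    assume "brk a z = 0"
    then have "brk z a = 0"
      using brk_antisym[of z a] by simp
    moreover have "a \<noteq> 0"
      using a assms(2) by auto
    ultimately obtain s t where st: "s \<noteq> 0" "scale s z = scale t a"
      using centralizer by blast
    from arg_cong[OF st(2), of f] have "s * f z = t * f a"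
      by (simp only: module_hom.scale[OF f(1)])
    with st(1) show False
      using f(2,3) a by simp
  qed
  then show ?thesis
    by blast
qed

lemma same_scalar_iff:
  assumes "a \<noteq> 0" "a' \<noteq> 0"
  shows "same_scalar brk a (scale k a) a' (scale k' a') \<longleftrightarrow> k = k'"
proof
  assume "same_scalar brk a (scale k a) a' (scale k' a')"
  then obtain z where "brk a z \<noteq> 0" "scale k z = scale k' z"
    by (auto simp: same_scalar_def transported_iff)
  then show "k = k'"
    using scale_cancel[of z] brk_zero(2) by metis
next
  obtain z where "brk a z \<noteq> 0" "brk a' z \<noteq> 0"
    using ex_noncommuting[of "{a, a'}"] assms by auto
  then show "k = k' \<Longrightarrow> same_scalar brk a (scale k a) a' (scale k' a')"
    by (auto simp: same_scalar_def transported_iff)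
qed

lemma plus_scalar_iff:
  assumes "a \<noteq> 0" "a' \<noteq> 0" "a'' \<noteq> 0"
  shows "(\<exists>z d d' d''. transported brk a (scale k a) z d \<and> transported brk a' (scale k' a') z d' \<and>
      transported brk a'' (scale k'' a'') z d'' \<and> d + d' = d'') \<longleftrightarrow> k + k' = k''"
proof -
  obtain z where z: "brk a z \<noteq> 0" "brk a' z \<noteq> 0" "brk a'' z \<noteq> 0"
    using ex_noncommuting[of "{a, a', a''}"] assms by auto
  have "k + k' = k''" if "brk a z \<noteq> 0" "scale k z + scale k' z = scale k'' z" for z
    using that scale_cancel[of z "k + k'" k''] brk_zero(2) by (metis scale_left_distrib)
  with z show ?thesis
    by (auto simp: transported_iff scale_left_distrib)
qed

text \<open>By bilinearity, \<open>k\<close> on the left argument and \<open>k'\<close> on the right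
  one combine to their product.\<close>

lemma times_scalar_iff:
  assumes "a \<noteq> 0" "a' \<noteq> 0" "a'' \<noteq> 0"
  shows "(\<exists>z d' d''. transported brk a' (scale k' a') z d' \<and>
      transported brk a'' (scale k'' a'') z d'' \<and> brk a z \<noteq> 0 \<and> brk (scale k a) d' = brk a d'')
      \<longleftrightarrow> k * k' = k''"
proof -
  obtain z where z: "brk a z \<noteq> 0" "brk a' z \<noteq> 0" "brk a'' z \<noteq> 0"
    using ex_noncommuting[of "{a, a', a''}"] assms by auto
  have "brk (scale k a) (scale k' z) = brk a (scale k'' z) \<longleftrightarrow> k * k' = k''"
    if "brk a z \<noteq> 0" for z
    using that scale_cancel[of "brk a z" "k * k'" k'']
    by (simp add: brk_scale_left brk_scale_right mult.commute[of k' k])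
  with z show ?thesis
    by (auto simp: transported_iff)
qed

text \<open>This is \<open>phi\<close> with \<open>b\<close> quantified away and \<open>k\<close>
  coded by the pair \<open>(u1, e)\<close>: the quotient \<open>u1\<close>, nonzero since
  \<open>v\<close> is, also serves as base of the scalar. Likewise \<open>f + u2\<close> stands for
  \<open>(k + 1) u2\<close>.\<close>

lemma nat_scalar_iff:
  assumes "a \<noteq> 0"
  shows "(\<exists>b v u. b \<noteq> 0 \<and> v \<noteq> 0 \<and> v = brk u b \<and>
      (\<forall>u1 e. v = brk u1 b + e \<and> scalar_pair brk u1 e \<longrightarrow>
         (\<exists>u2 f. v = brk u2 b + (f + u2) \<and> scalar_pair brk u2 f \<and> same_scalar brk u1 e u2 f) \<or>
         same_scalar brk u1 e a (scale x a))) \<longleftrightarrow> x \<in> \<nat>"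
    (is "?lhs \<longleftrightarrow> _")
proof -
  have step: "(\<forall>u1 e. v = brk u1 b + e \<and> scalar_pair brk u1 e \<longrightarrow>
         (\<exists>u2 f. v = brk u2 b + (f + u2) \<and> scalar_pair brk u2 f \<and> same_scalar brk u1 e u2 f) \<or>
         same_scalar brk u1 e a (scale x a)) \<longleftrightarrow>
      (\<forall>k u1. v = shift u1 b k \<longrightarrow> (\<exists>u2. v = shift u2 b (k + 1)) \<or> k = x)"
    (is "?A \<longleftrightarrow> ?B") if v: "v \<noteq> 0" for v b
  proof -
    have u_nonzero: "u \<noteq> 0" if "v = shift u b k" for u k
      using that v by auto
    have next_iff: "(\<exists>u2 f. v = brk u2 b + (f + u2) \<and> scalar_pair brk u2 f \<and>
        same_scalar brk u1 (scale k u1) u2 f) \<longleftrightarrow> (\<exists>u2. v = shift u2 b (k + 1))"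
      if u1: "u1 \<noteq> 0" for u1 k
    proof
      assume "\<exists>u2 f. v = brk u2 b + (f + u2) \<and> scalar_pair brk u2 f \<and>
        same_scalar brk u1 (scale k u1) u2 f"
      then obtain u2 k' where u2: "u2 \<noteq> 0" "v = brk u2 b + (scale k' u2 + u2)"
        "same_scalar brk u1 (scale k u1) u2 (scale k' u2)"
        by (auto simp: scalar_pair_iff)
      then have "k' = k"
        using same_scalar_iff[OF u1 u2(1)] by auto
      with u2(2) show "\<exists>u2. v = shift u2 b (k + 1)"
        by (auto simp: brk_shift_def scale_left_distrib)
    next
      assume "\<exists>u2. v = shift u2 b (k + 1)"
      then obtain u2 where u2: "v = shift u2 b (k + 1)"
        by blast
      then have "v = brk u2 b + (scale k u2 + u2)"
        by (simp add: brk_shift_def scale_left_distrib)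
      with u_nonzero[OF u2] show "\<exists>u2 f. v = brk u2 b + (f + u2) \<and> scalar_pair brk u2 f \<and>
        same_scalar brk u1 (scale k u1) u2 f"
        by (intro exI[of _ u2] exI[of _ "scale k u2"])
          (auto simp: scalar_pair_iff same_scalar_iff[OF u1])
    qed
    have next_or_last: "((\<exists>u2 f. v = brk u2 b + (f + u2) \<and> scalar_pair brk u2 f \<and>
          same_scalar brk u1 (scale k u1) u2 f) \<or> same_scalar brk u1 (scale k u1) a (scale x a))
        \<longleftrightarrow> (\<exists>u2. v = shift u2 b (k + 1)) \<or> k = x" if u1: "u1 \<noteq> 0" for u1 k
      by (simp only: next_iff[OF u1] same_scalar_iff[OF u1 assms])
    have "?A \<longleftrightarrow> (\<forall>u1 k. u1 \<noteq> 0 \<and> v = shift u1 b k \<longrightarrow>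
         (\<exists>u2 f. v = brk u2 b + (f + u2) \<and> scalar_pair brk u2 f \<and>
           same_scalar brk u1 (scale k u1) u2 f) \<or> same_scalar brk u1 (scale k u1) a (scale x a))"
      unfolding scalar_pair_iff[of _ "_ :: 'l"] brk_shift_def by blast
    also have "\<dots> \<longleftrightarrow> ?B"
      using u_nonzero next_or_last by blast
    finally show ?thesis .
  qed
  have "?lhs \<longleftrightarrow> (\<exists>b v u. b \<noteq> 0 \<and> v \<noteq> 0 \<and> v = brk u b \<and>
      (\<forall>k u1. v = shift u1 b k \<longrightarrow> (\<exists>u2. v = shift u2 b (k + 1)) \<or> k = x))"
    using step by (intro ex_cong1 conj_cong refl) blast
  also have "\<dots> \<longleftrightarrow> (\<exists>b. b \<noteq> 0 \<and> phi scale brk x b)"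
    unfolding phi_def by blast
  also have "\<dots> \<longleftrightarrow> x \<in> \<nat>"
    using phi_iff assms by blast
  finally show ?thesis .
qed

end

section \<open>First-order formulas for the scalars\<close>

definition fm_or :: "ring_fm \<Rightarrow> ring_fm \<Rightarrow> ring_fm" where
  "fm_or p q = FNot (FAnd (FNot p) (FNot q))"

definition fm_imp :: "ring_fm \<Rightarrow> ring_fm \<Rightarrow> ring_fm" where
  "fm_imp p q = FNot (FAnd p (FNot q))"

definition fm_all :: "nat \<Rightarrow> ring_fm \<Rightarrow> ring_fm" where
  "fm_all i p = FNot (FEx i (FNot p))"

definition fm_nonzero :: "ring_term \<Rightarrow> ring_fm" where
  "fm_nonzero s = FNot (FEq s RZero)"

text \<open>The variables \<open>i\<close>, \<open>j\<close> to be bound are arguments, so that each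
  use can choose fresh ones and avoid capture.\<close>

definition fm_scalar_pair :: "nat \<Rightarrow> nat \<Rightarrow> nat \<Rightarrow> nat \<Rightarrow> ring_fm" where
  "fm_scalar_pair i j a c = FAnd (fm_nonzero (RVar a)) (FAnd (FEq (RTimes (RVar c) (RVar a)) RZero)
     (fm_all i (FEx j (FEq (RTimes (RVar c) (RVar i)) (RTimes (RVar a) (RVar j))))))"

definition fm_transported :: "nat \<Rightarrow> nat \<Rightarrow> nat \<Rightarrow> nat \<Rightarrow> ring_fm" where
  "fm_transported a c z d = FAnd (fm_nonzero (RTimes (RVar a) (RVar z)))
     (FAnd (FEq (RTimes (RVar c) (RVar z)) (RTimes (RVar a) (RVar d)))
       (FEq (RTimes (RVar d) (RVar z)) RZero))"

definition fm_same_scalar :: "nat \<Rightarrow> nat \<Rightarrow> nat \<Rightarrow> nat \<Rightarrow> nat \<Rightarrow> nat \<Rightarrow> ring_fm" where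
  "fm_same_scalar z d a c a' c' =
     FEx z (FEx d (FAnd (fm_transported a c z d) (fm_transported a' c' z d)))"

lemma sat_connectives [simp]:
  "ring_sat mul e (fm_or p q) \<longleftrightarrow> ring_sat mul e p \<or> ring_sat mul e q"
  "ring_sat mul e (fm_imp p q) \<longleftrightarrow> (ring_sat mul e p \<longrightarrow> ring_sat mul e q)"
  "ring_sat mul e (fm_all i p) \<longleftrightarrow> (\<forall>a. ring_sat mul (e(i := a)) p)"
  "ring_sat mul e (fm_nonzero s) \<longleftrightarrow> rt_val mul e s \<noteq> 0"
  by (simp_all add: fm_or_def fm_imp_def fm_all_def fm_nonzero_def)

lemma free_vars_connectives [simp]:
  "free_vars (fm_or p q) = free_vars p \<union> free_vars q"
  "free_vars (fm_imp p q) = free_vars p \<union> free_vars q"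
  "free_vars (fm_all i p) = free_vars p - {i}"
  "free_vars (fm_nonzero s) = rt_vars s"
  by (simp_all add: fm_or_def fm_imp_def fm_all_def fm_nonzero_def)

lemma sat_scalar_pair [simp]:
  "distinct [i, j, a] \<Longrightarrow> distinct [i, j, c] \<Longrightarrow>
    ring_sat mul e (fm_scalar_pair i j a c) \<longleftrightarrow> scalar_pair mul (e a) (e c)"
  by (simp add: fm_scalar_pair_def scalar_pair_def)

lemma sat_transported [simp]:
  "ring_sat mul e (fm_transported a c z d) \<longleftrightarrow> transported mul (e a) (e c) (e z) (e d)"
  by (simp add: fm_transported_def transported_def)

lemma sat_same_scalar [simp]:
  "distinct [z, d] \<Longrightarrow> {z, d} \<inter> {a, c, a', c'} = {} \<Longrightarrow>
    ring_sat mul e (fm_same_scalar z d a c a' c') \<longleftrightarrow> same_scalar mul (e a) (e c) (e a') (e c')"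
  by (auto simp: fm_same_scalar_def same_scalar_def)

lemma free_vars_scalar [simp]:
  "free_vars (fm_scalar_pair i j a c) = {a, c}"
  "free_vars (fm_transported a c z d) = {a, c, z, d}"
  "free_vars (fm_same_scalar z d a c a' c') = {a, c, a', c'} - {z, d}"
  by (auto simp: fm_scalar_pair_def fm_transported_def fm_same_scalar_def)

text \<open>Variables \<open>0\<close>, \<open>1\<close> hold the given pair; \<open>2\<close>,
  \<open>3\<close>, \<open>4\<close> are \<open>b\<close>, \<open>v\<close>, \<open>u\<close>;
  \<open>5\<close>, \<open>6\<close> are \<open>u1\<close>, \<open>e\<close>; \<open>7\<close>,
  \<open>8\<close> are \<open>u2\<close>, \<open>f\<close>; \<open>9\<close>, \<open>10\<close> are
  bound inside subformulas.\<close>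

definition fm_nat :: ring_fm where
  "fm_nat = FEx 2 (FEx 3 (FEx 4 (FAnd (fm_nonzero (RVar 2)) (FAnd (fm_nonzero (RVar 3))
     (FAnd (FEq (RVar 3) (RTimes (RVar 4) (RVar 2))) (fm_all 5 (fm_all 6 (fm_imp
       (FAnd (FEq (RVar 3) (RPlus (RTimes (RVar 5) (RVar 2)) (RVar 6))) (fm_scalar_pair 9 10 5 6))
       (fm_or
         (FEx 7 (FEx 8
           (FAnd (FEq (RVar 3) (RPlus (RTimes (RVar 7) (RVar 2)) (RPlus (RVar 8) (RVar 7))))
             (FAnd (fm_scalar_pair 9 10 7 8) (fm_same_scalar 9 10 5 6 7 8)))))
         (fm_same_scalar 9 10 5 6 0 1))))))))))"

text \<open>Each argument is a pair and takes two consecutive variables, starting from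
  \<open>0\<close>.\<close>

primrec scalar_fm :: "ring_nat_sym \<Rightarrow> ring_fm" where
  "scalar_fm SPlus = FEx 6 (FEx 7 (FEx 8 (FEx 9 (FAnd (fm_transported 0 1 6 7)
     (FAnd (fm_transported 2 3 6 8) (FAnd (fm_transported 4 5 6 9)
       (FEq (RPlus (RVar 7) (RVar 8)) (RVar 9))))))))"
| "scalar_fm STimes = FEx 6 (FEx 7 (FEx 8 (FAnd (fm_transported 2 3 6 7)
     (FAnd (fm_transported 4 5 6 8) (FAnd (fm_nonzero (RTimes (RVar 0) (RVar 6)))
       (FEq (RTimes (RVar 1) (RVar 7)) (RTimes (RVar 0) (RVar 8))))))))"
| "scalar_fm SZero = FEq (RVar 1) RZero"
| "scalar_fm SOne = FEq (RVar 0) (RVar 1)"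
| "scalar_fm SNat = fm_nat"

context lie_algebra_with_degree
begin

definition scalar_of :: "'l list \<Rightarrow> 'r" where
  "scalar_of xs = (THE k. xs ! 1 = scale k (xs ! 0))"

lemma scalar_of: "a \<noteq> 0 \<Longrightarrow> scalar_of [a, scale k a] = k"
  unfolding scalar_of_def by (rule the_equality) (simp_all add: scale_cancel)

lemma sat_scalar_fm:
  assumes "\<And>x. x \<in> set xss \<Longrightarrow> \<exists>a k. a \<noteq> 0 \<and> x = [a, scale k a]" "length xss = ring_nat_arity s"
  shows "ring_sat brk ((!) (concat xss)) (scalar_fm s) \<longleftrightarrow> ring_nat_rel s (map scalar_of xss)"
proof -
  have three: "\<exists>x y z. xss = [x, y, z]" if "length xss = 3"
    using that by (auto simp: eval_nat_numeral length_Suc_conv)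
  have one: "\<exists>x. xss = [x]" if "length xss = 1"
    using that by (auto simp: length_Suc_conv)
  show ?thesis
  proof (cases s)
    case SPlus
    with assms(2) three obtain x y z where xyz: "xss = [x, y, z]"
      by auto
    from assms(1)[of x] assms(1)[of y] assms(1)[of z] obtain a k a' k' a'' k'' where
      *: "a \<noteq> 0" "x = [a, scale k a]" "a' \<noteq> 0" "y = [a', scale k' a']" "a'' \<noteq> 0"
      "z = [a'', scale k'' a'']"
      by (auto simp: xyz)
    then show ?thesis
      using plus_scalar_iff[of a a' a'' k k' k''] by (simp add: SPlus xyz scalar_of nth_Cons')
  next
    case STimes
    with assms(2) three obtain x y z where xyz: "xss = [x, y, z]"
      by auto
    from assms(1)[of x] assms(1)[of y] assms(1)[of z] obtain a k a' k' a'' k'' where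
      *: "a \<noteq> 0" "x = [a, scale k a]" "a' \<noteq> 0" "y = [a', scale k' a']" "a'' \<noteq> 0"
      "z = [a'', scale k'' a'']"
      by (auto simp: xyz)
    then show ?thesis
      using times_scalar_iff[of a a' a'' k' k'' k] by (simp add: STimes xyz scalar_of nth_Cons')
  next
    case SZero
    with assms one obtain a k where "a \<noteq> 0" "xss = [[a, scale k a]]"
      by fastforce
    then show ?thesis
      using torsion_free[of k a] by (auto simp: SZero scalar_of)
  next
    case SOne
    with assms one obtain a k where "a \<noteq> 0" "xss = [[a, scale k a]]"
      by fastforce
    then show ?thesis
      using scale_cancel[of a 1 k] by (auto simp: SOne scalar_of)
  next
    case SNat
    with assms one obtain a k where "a \<noteq> 0" "xss = [[a, scale k a]]"
      by fastforce
    then show ?thesis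
      using nat_scalar_iff[of a k] by (simp add: SNat fm_nat_def scalar_of)
  qed
qed

theorem scalars_interpretable:
  "zero_interpretable (UNIV :: 'r set) ring_nat_arity ring_nat_rel brk"
proof -
  define D where "D = {xs :: 'l list. length xs = 2 \<and> ring_sat brk ((!) xs) (fm_scalar_pair 2 3 0 1)}"
  define E where "E = {(xs, ys). xs \<in> D \<and> ys \<in> D \<and>
    ring_sat brk ((!) (xs @ ys)) (fm_same_scalar 4 5 0 1 2 3)}"
  \<comment> \<open>\<open>scalar_of\<close> is constant on a class, so its image there is a
    singleton.\<close>
  define g where "g C = the_elem (scalar_of ` C)" for C
  have D: "xs \<in> D \<longleftrightarrow> (\<exists>a k. a \<noteq> 0 \<and> xs = [a, scale k a])" for xs
    by (auto simp: D_def scalar_pair_iff length_Suc_conv eval_nat_numeral)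
  have E: "E = {(xs, ys). xs \<in> D \<and> ys \<in> D \<and> scalar_of xs = scalar_of ys}"
    by (auto simp: E_def D scalar_of same_scalar_iff)
  have equiv: "equiv D E"
    by (auto simp: E equiv_def refl_on_def sym_def trans_def)
  have g: "g (E `` {xs}) = scalar_of xs" if "xs \<in> D" for xs
  proof -
    have "scalar_of ` (E `` {xs}) = {scalar_of xs}"
      using that by (auto simp: E)
    then show ?thesis
      by (simp add: g_def)
  qed
  have bij: "bij_betw g (D // E) UNIV"
    unfolding bij_betw_def
  proof
    show "inj_on g (D // E)"
    proof (rule inj_onI)
      fix C C' assume "C \<in> D // E" "C' \<in> D // E" and eq: "g C = g C'"
      then obtain xs ys where xs: "xs \<in> D" "C = E `` {xs}" and ys: "ys \<in> D" "C' = E `` {ys}"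
        by (auto elim!: quotientE)
      have "scalar_of xs = scalar_of ys"
        using eq g[OF xs(1)] g[OF ys(1)] xs(2) ys(2) by simp
      then show "C = C'"
        using xs ys by (simp add: E Image_def)
    qed
    \<comment> \<open>The instance \<open>b = 0\<close> yields a nonzero element, the base on which
      every scalar is represented.\<close>
    obtain a where "\<forall>c d. scale c a = scale d 0 \<longrightarrow> c = 0"
      using ex_deg_one_independent[of 0] by blast
    then have a: "a \<noteq> 0"
      using zero_neq_one by metis
    show "g ` (D // E) = UNIV"
    proof (intro set_eqI iffI UNIV_I)
      fix k
      have "[a, scale k a] \<in> D"
        using a by (auto simp: D)
      then have "E `` {[a, scale k a]} \<in> D // E" "g (E `` {[a, scale k a]}) = k"
        using a by (auto simp: g scalar_of intro: quotientI)
      then show "k \<in> g ` (D // E)"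
        by force
    qed
  qed
  have rel: "ring_sat brk ((!) (concat xss)) (scalar_fm s) \<longleftrightarrow>
      ring_nat_rel s (map (\<lambda>xs. g (E `` {xs})) xss)"
    if "length xss = ring_nat_arity s" "set xss \<subseteq> D" for s xss
  proof -
    have "map (\<lambda>xs. g (E `` {xs})) xss = map scalar_of xss"
      using that(2) g by auto
    moreover have "ring_sat brk ((!) (concat xss)) (scalar_fm s) \<longleftrightarrow> ring_nat_rel s (map scalar_of xss)"
      using that D by (intro sat_scalar_fm) auto
    ultimately show ?thesis
      by (simp only:)
  qed
  have fv: "free_vars (scalar_fm s) \<subseteq> {..<ring_nat_arity s * 2}" for s
    by (cases s) (auto simp: fm_nat_def)
  show ?thesis
    unfolding zero_interpretable_def
  proof (intro exI conjI)
    show "free_vars (fm_scalar_pair 2 3 0 1) \<subseteq> {..<2}"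
      "free_vars (fm_same_scalar 4 5 0 1 2 3) \<subseteq> {..<2 * 2}"
      by auto
    show "\<forall>s. free_vars (scalar_fm s) \<subseteq> {..<ring_nat_arity s * 2}"
      using fv by blast
    show "D = {xs. length xs = 2 \<and> ring_sat brk ((!) xs) (fm_scalar_pair 2 3 0 1)}"
      by (fact D_def)
    show "E = {(xs, ys). xs \<in> D \<and> ys \<in> D \<and>
        ring_sat brk ((!) (xs @ ys)) (fm_same_scalar 4 5 0 1 2 3)}"
      by (fact E_def)
    show "equiv D E" "bij_betw g (D // E) UNIV"
      by fact+
    show "\<forall>s xss. length xss = ring_nat_arity s \<longrightarrow> set xss \<subseteq> D \<longrightarrow>
        ring_sat brk ((!) (concat xss)) (scalar_fm s) =
        ring_nat_rel s (map (\<lambda>xs. g (E `` {xs})) xss)"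
      using rel by blast
  qed
qed

end

section \<open>From free Lie algebras to the degree axioms, and the conclusion\<close>

lemma free_lie_algebra_has_degree:
  fixes scale :: "'r::{idom, ring_char_0} \<Rightarrow> 'l::ab_group_add \<Rightarrow> 'l"
  assumes "free_lie_algebra scale brk" "brk u v \<noteq> 0"
  shows "\<exists>deg. lie_algebra_with_degree scale brk deg"
proof -
  interpret free_lie_algebra scale brk
    by fact
  obtain X where X: "free_lie_basis scale brk X"
    using ex_free_basis by blast
  obtain w :: "'l rel" where "Well_order w" "Field w = UNIV"
    using well_ordering[where 'a = 'l] by blast
  then have "strict_linear_order (w - Id)"
    by (intro strict_linear_order_on_diff_Id) (simp add: well_order_on_def)
  then interpret free_lie_algebra_on scale brk "w - Id" X
    by unfold_locales (use X in auto)
  \<comment> \<open>Totality of the order allows naming two distinct generators so that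
    \<open>x\<close> is the smaller one.\<close>
  obtain x y where xy: "x \<in> X" "y \<in> X" "(x, y) \<in> w - Id"
    using free_lie_basis_two_elements[OF X assms(2)] letters(3) by (metis UNIV_I total_on_def)
  then have "x \<noteq> y"
    by blast
  have "lie_algebra_with_degree scale brk deg"
    by unfold_locales
      (use scale_eq_zero deg_zero deg_pos deg_add deg_scale deg_brk_reduced ex_separated[OF xy]
        ex_deg_one_independent[OF xy(1,2) \<open>x \<noteq> y\<close>] in blast)+
  then show ?thesis
    by blast
qed

theorem theorem3p2:
  fixes scale :: "'r::{idom, ring_char_0} \<Rightarrow> 'l::ab_group_add \<Rightarrow> 'l"
    and brk :: "'l \<Rightarrow> 'l \<Rightarrow> 'l"
  assumes "free_lie_algebra scale brk"
    and "\<exists>x y. brk x y \<noteq> 0"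
  shows "(\<forall>b. b \<noteq> 0 \<longrightarrow> {x. phi scale brk x b} = \<nat>) \<and>
         {x. \<exists>b. b \<noteq> 0 \<and> phi scale brk x b} = \<nat> \<and>
         zero_interpretable (UNIV :: 'r set) ring_nat_arity ring_nat_rel brk"
proof -
  obtain u v where uv: "brk u v \<noteq> 0"
    using assms(2) by blast
  obtain deg where "lie_algebra_with_degree scale brk deg"
    using free_lie_algebra_has_degree[OF assms(1) uv] by blast
  then interpret lie_algebra_with_degree scale brk deg .
  \<comment> \<open>The second set is nonempty only if some nonzero \<open>b\<close> exists;
    \<open>u\<close> is one.\<close>
  have "u \<noteq> 0"
    using uv by auto
  then show ?thesis
    using phi_iff scalars_interpretable by blast
qed

end
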